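(* Let $\mathfrak{g}$ be the $n$-dimensional Lie algebra of a Lie group $G$, let $\gamma=\frac{\partial}{\partial t}+\gamma^i\frac{\partial}{\partial w^i}$ be a reduced vector field on $M=\mathbb{R}\times\mathfrak{g}$ (with $\gamma^i\in C^\infty(M)$), and let $A\to M$ be the IP Lie algebroid with sections $\Gamma_0,W_i$ as in the context. A reduced multiplier matrix for $\gamma$ exists if and only if there exists a two-form $\Omega\in\Lambda^2(A)$ such that 1. $\Omega$ is of maximal rank, in the sense that the $n$-fold wedge product $\Omega\wedge\dots\wedge\Omega$ is nowhere vanishing, 2. $\Omega(W_i,W_j)=0$ for all $i,j$, 3. $\iota_{\Gamma_0}\Omega=0$, 4. $\delta\Omega=0$.
   Context: Summation convention. $\{E_i\}$ is a basis of $\mathfrak{g}$ with $[E_i,E_j]=C_{ij}^kE_k$, and $w^i$ are the corresponding linear coordinates on $\mathfrak{g}$. Reduced multiplier: set $$\lambda_i^j=\tfrac12\Big(w^kC_{ki}^j-\frac{\partial\gamma^j}{\partial w^i}\Big),\qquad\phi_i^j=-w^kC_{ki}^l\frac{\partial\gamma^j}{\partial w^l}-\gamma^kC_{ik}^j-\gamma(\lambda_i^j)-\lambda_i^k\lambda_k^j.$$ A matrix $(k_{ij})$ of smooth functions on $\mathbb{R}\times\mathfrak{g}$ is a reduced multiplier matrix for $\gamma$ if $\det(k_{ij})\neq0$, $k_{ij}=k_{ji}$, $\gamma(k_{ij})-k_{kj}\lambda_i^k-k_{ik}\lambda_j^k=0$, $k_{ki}\phi_j^k=k_{kj}\phi_i^k$,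 and $\frac{\partial k_{jk}}{\partial w^i}=\frac{\partial k_{ik}}{\partial w^j}$. IP Lie algebroid: the trivial vector bundle $A=M\times(\mathbb{R}\times\mathfrak{g}\times\mathfrak{g})\to M=\mathbb{R}\times\mathfrak{g}$ with basis of sections $T_0(t,w)=(t,w,1,0,0)$, $e_i(t,w)=(t,w,0,E_i,0)$, $W_i(t,w)=(t,w,0,0,E_i)$; anchor $\rho(T_0)=\frac{\partial}{\partial t}$, $\rho(e_i)=w^kC_{ki}^j\frac{\partial}{\partial w^j}$, $\rho(W_i)=\frac{\partial}{\partial w^i}$; and bracket determined by $\llbracket T_0,e_i\rrbracket=0$, $\llbracket T_0,W_i\rrbracket=0$, $\llbracket e_i,e_j\rrbracket=C_{ij}^ke_k$, $\llbracket e_i,W_j\rrbracket=C_{ij}^kW_k$, $\llbracket W_i,W_j\rrbracket=0$ together with the Leibniz rule $\llbracket\sigma_1,f\sigma_2\rrbracket=\rho(\sigma_1)(f)\sigma_2+f\llbracket\sigma_1,\sigma_2\rrbracket$. Put $\Gamma_0=T_0+w^je_j+\gamma^jW_j$. $\Lambda^q(A)$ denotes $q$-forms on $A$ (sections of $\wedge^qA^*$), $\iota$ is the interior product, and $\delta\colon\Lambda^q(A)\to\Lambda^{q+1}(A)$ is the Lie algebroid exterior derivative: $\delta f(\sigma)=\rho(\sigma)f$ and, for $q\geq1$, $$\delta\omega(\sigma_1,\dots,\sigma_{q+1})=\sum_i(-1)^{i+1}\rho(\sigma_i)(\omega(\dots,\hat\sigma_i,\dots))+\sum_{i<j}(-1)^{i+j}\omega(\llbracket\sigma_i,\sigma_j\rrbracket,\dots,\hat\sigma_i,\dots,\hat\sigma_j,\dots).$$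 *)

theory Defs
  imports "HOL-Analysis.Analysis"
begin

section \<open>Smooth functions\<close>

text \<open>On a finite-dimensional space, continuity of all iterated directional derivatives up to
  order \<open>k\<close> is the usual notion of \<open>C^k\<close>.\<close>

primrec Ck :: "nat \<Rightarrow> ('a::real_normed_vector \<Rightarrow> 'b::real_normed_vector) \<Rightarrow> bool" where
  "Ck 0 f \<longleftrightarrow> continuous_on UNIV f"
| "Ck (Suc k) f \<longleftrightarrow> (\<forall>x. f differentiable (at x)) \<and>
     (\<forall>v. Ck k (\<lambda>x. frechet_derivative f (at x) v))"

definition smooth :: "('a::real_normed_vector \<Rightarrow> 'b::real_normed_vector) \<Rightarrow> bool" where
  "smooth f \<longleftrightarrow> (\<forall>k. Ck k f)"

section \<open>Lie algebra, basis and coordinates\<close>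

text \<open>Every finite-dimensional real Lie algebra is the Lie algebra of a Lie group (Lie's third
  theorem), so the Lie group itself does not appear. The Euclidean structure of the carrier type
  only provides the standard topology of a finite-dimensional real vector space.\<close>

definition lie_algebra :: "('g::real_vector \<Rightarrow> 'g \<Rightarrow> 'g) \<Rightarrow> bool" where
  "lie_algebra br \<longleftrightarrow>
     (\<forall>x. linear (br x)) \<and> (\<forall>y. linear (\<lambda>x. br x y)) \<and>
     (\<forall>x. br x x = 0) \<and>
     (\<forall>x y z. br x (br y z) + br y (br z x) + br z (br x y) = 0)"

definition is_basis :: "('n \<Rightarrow> 'g::real_vector) \<Rightarrow> bool" where
  "is_basis E \<longleftrightarrow> inj E \<and> independent (range E) \<and> span (range E) = UNIV"

definition coord :: "('n \<Rightarrow> 'g::real_vector) \<Rightarrow> 'n \<Rightarrow> 'g \<Rightarrow> real" where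
  "coord E i w = representation (range E) w (E i)"

text \<open>\<open>struct_const br E i j k\<close> is $C_{ij}^k$.\<close>

definition struct_const ::
    "('g::real_vector \<Rightarrow> 'g \<Rightarrow> 'g) \<Rightarrow> ('n \<Rightarrow> 'g) \<Rightarrow> 'n \<Rightarrow> 'n \<Rightarrow> 'n \<Rightarrow> real" where
  "struct_const br E i j k = coord E k (br (E i) (E j))"

text \<open>The base manifold is the type \<open>real \<times> 'g\<close>. As \<open>E\<close> is the basis dual to the linear
  coordinates, $\partial/\partial w^i$ is the derivative in direction \<open>E i\<close>.\<close>

definition pdt :: "(real \<times> 'g::real_normed_vector \<Rightarrow> real) \<Rightarrow> real \<times> 'g \<Rightarrow> real" where
  "pdt f p = frechet_derivative f (at p) (1, 0)"

definition pdw :: "('n \<Rightarrow> 'g::real_normed_vector) \<Rightarrow> 'n \<Rightarrow>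
    (real \<times> 'g \<Rightarrow> real) \<Rightarrow> real \<times> 'g \<Rightarrow> real" where
  "pdw E i f p = frechet_derivative f (at p) (0, E i)"

section \<open>Reduced multiplier matrices\<close>

text \<open>A reduced vector field $\partial_t + \gamma^i \partial_{w^i}$ is given by its family
  \<open>\<gamma>\<close> of components; \<open>gam_deriv E \<gamma> f\<close> is its action on \<open>f\<close>.\<close>

definition gam_deriv :: "('n::finite \<Rightarrow> 'g::real_normed_vector) \<Rightarrow> ('n \<Rightarrow> real \<times> 'g \<Rightarrow> real) \<Rightarrow>
    (real \<times> 'g \<Rightarrow> real) \<Rightarrow> real \<times> 'g \<Rightarrow> real" where
  "gam_deriv E \<gamma> f p = pdt f p + (\<Sum>i\<in>UNIV. \<gamma> i p * pdw E i f p)"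

text \<open>\<open>lam br E \<gamma> i j\<close> is $\lambda_i^j$ and \<open>phi br E \<gamma> i j\<close> is $\phi_i^j$.\<close>

definition lam :: "('g::real_normed_vector \<Rightarrow> 'g \<Rightarrow> 'g) \<Rightarrow> ('n::finite \<Rightarrow> 'g) \<Rightarrow>
    ('n \<Rightarrow> real \<times> 'g \<Rightarrow> real) \<Rightarrow> 'n \<Rightarrow> 'n \<Rightarrow> real \<times> 'g \<Rightarrow> real" where
  "lam br E \<gamma> i j p =
     1/2 * ((\<Sum>k\<in>UNIV. coord E k (snd p) * struct_const br E k i j) - pdw E i (\<gamma> j) p)"

definition phi :: "('g::real_normed_vector \<Rightarrow> 'g \<Rightarrow> 'g) \<Rightarrow> ('n::finite \<Rightarrow> 'g) \<Rightarrow>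
    ('n \<Rightarrow> real \<times> 'g \<Rightarrow> real) \<Rightarrow> 'n \<Rightarrow> 'n \<Rightarrow> real \<times> 'g \<Rightarrow> real" where
  "phi br E \<gamma> i j p =
     - (\<Sum>k\<in>UNIV. \<Sum>l\<in>UNIV. coord E k (snd p) * struct_const br E k i l * pdw E l (\<gamma> j) p)
     - (\<Sum>k\<in>UNIV. \<gamma> k p * struct_const br E i k j)
     - gam_deriv E \<gamma> (lam br E \<gamma> i j) p
     - (\<Sum>k\<in>UNIV. lam br E \<gamma> i k p * lam br E \<gamma> k j p)"

definition reduced_multiplier :: "('g::real_normed_vector \<Rightarrow> 'g \<Rightarrow> 'g) \<Rightarrow> ('n::finite \<Rightarrow> 'g) \<Rightarrow>
    ('n \<Rightarrow> real \<times> 'g \<Rightarrow> real) \<Rightarrow> ('n \<Rightarrow> 'n \<Rightarrow> real \<times> 'g \<Rightarrow> real) \<Rightarrow> bool" where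
  "reduced_multiplier br E \<gamma> K \<longleftrightarrow>
     (\<forall>i j. smooth (K i j)) \<and>
     (\<forall>p. det (\<chi> i j. K i j p) \<noteq> 0) \<and>
     (\<forall>p i j. K i j p = K j i p) \<and>
     (\<forall>p i j. gam_deriv E \<gamma> (K i j) p
        - (\<Sum>k\<in>UNIV. K k j p * lam br E \<gamma> i k p)
        - (\<Sum>k\<in>UNIV. K i k p * lam br E \<gamma> j k p) = 0) \<and>
     (\<forall>p i j. (\<Sum>k\<in>UNIV. K k i p * phi br E \<gamma> j k p)
            = (\<Sum>k\<in>UNIV. K k j p * phi br E \<gamma> i k p)) \<and>
     (\<forall>p i j k. pdw E i (K j k) p = pdw E j (K i k) p)"

section \<open>The IP Lie algebroid\<close>

text \<open>The fibre of the trivial bundle $A$ is \<open>real \<times> 'g \<times> 'g\<close>; a section is represented by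
  its fibre component, a function from \<open>real \<times> 'g\<close> to the fibre. \<open>We\<close> is the family $W_i$.\<close>

type_synonym 'g fibre = "real \<times> 'g \<times> 'g"
type_synonym 'g sect = "real \<times> 'g \<Rightarrow> 'g fibre"

definition T0 :: "('g::real_normed_vector) sect" where
  "T0 = (\<lambda>p. (1, 0, 0))"

definition ee :: "('n \<Rightarrow> 'g::real_normed_vector) \<Rightarrow> 'n \<Rightarrow> 'g sect" where
  "ee E i = (\<lambda>p. (0, E i, 0))"

definition We :: "('n \<Rightarrow> 'g::real_normed_vector) \<Rightarrow> 'n \<Rightarrow> 'g sect" where
  "We E i = (\<lambda>p. (0, 0, E i))"

definition Gamma0 :: "('n::finite \<Rightarrow> 'g::real_normed_vector) \<Rightarrow>
    ('n \<Rightarrow> real \<times> 'g \<Rightarrow> real) \<Rightarrow> 'g sect" where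
  "Gamma0 E \<gamma> = (\<lambda>p. T0 p + (\<Sum>j\<in>UNIV. coord E j (snd p) *\<^sub>R ee E j p)
                           + (\<Sum>j\<in>UNIV. \<gamma> j p *\<^sub>R We E j p))"

text \<open>The anchor and the bracket are written without a basis. The lemmas named \<open>anchor_\<close>\<dots> and
  \<open>bracket_\<close>\<dots> below show that they take the prescribed values on \<open>T0\<close>, \<open>ee E i\<close>, \<open>We E i\<close>
  and that the bracket is additive, skew-symmetric and satisfies the Leibniz rule; as these
  sections form a frame, this determines the bracket.\<close>

fun anchor :: "('g::real_normed_vector \<Rightarrow> 'g \<Rightarrow> 'g) \<Rightarrow> real \<times> 'g \<Rightarrow> 'g fibre \<Rightarrow> real \<times> 'g" where
  "anchor br (t, w) (a, u, v) = (a, br w u + v)"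

definition anchor_deriv :: "('g::real_normed_vector \<Rightarrow> 'g \<Rightarrow> 'g) \<Rightarrow> 'g sect \<Rightarrow>
    (real \<times> 'g \<Rightarrow> 'b::real_normed_vector) \<Rightarrow> real \<times> 'g \<Rightarrow> 'b" where
  "anchor_deriv br \<sigma> f p = frechet_derivative f (at p) (anchor br p (\<sigma> p))"

fun fibre_bracket :: "('g::real_normed_vector \<Rightarrow> 'g \<Rightarrow> 'g) \<Rightarrow> 'g fibre \<Rightarrow> 'g fibre \<Rightarrow> 'g fibre" where
  "fibre_bracket br (a1, u1, v1) (a2, u2, v2) = (0, br u1 u2, br u1 v2 + br v1 u2)"

definition bracket :: "('g::real_normed_vector \<Rightarrow> 'g \<Rightarrow> 'g) \<Rightarrow> 'g sect \<Rightarrow> 'g sect \<Rightarrow> 'g sect" where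
  "bracket br \<sigma>1 \<sigma>2 = (\<lambda>p. anchor_deriv br \<sigma>1 \<sigma>2 p - anchor_deriv br \<sigma>2 \<sigma>1 p
                             + fibre_bracket br (\<sigma>1 p) (\<sigma>2 p))"

lemma lie_algebra_linear:
  assumes "lie_algebra br"
  shows "linear (br x)" "linear (\<lambda>x. br x y)"
  using assms by (auto simp: lie_algebra_def)

lemmas lie_algebra_bilin_simps =
  lie_algebra_linear[THEN linear_0] lie_algebra_linear[THEN linear_add]
  lie_algebra_linear[THEN linear_diff] lie_algebra_linear[THEN linear_neg]
  lie_algebra_linear[THEN linear_scale]

lemma lie_algebra_skew:
  assumes "lie_algebra br"
  shows "br x y = - br y x"
proof -
  have "br (x + y) (x + y) = 0" "br x x = 0" "br y y = 0"
    using assms by (auto simp: lie_algebra_def)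
  then show ?thesis
    by (simp add: lie_algebra_bilin_simps[OF assms] eq_neg_iff_add_eq_0 add.commute)
qed

lemma basis_expansion:
  fixes E :: "'n::finite \<Rightarrow> 'g::real_vector"
  assumes "is_basis E"
  shows "(\<Sum>i\<in>UNIV. coord E i x *\<^sub>R E i) = x"
proof -
  have "(\<Sum>b\<in>range E. representation (range E) x b *\<^sub>R b) = x"
    using assms by (intro real_vector.sum_representation_eq) (auto simp: is_basis_def)
  then show ?thesis
    using assms by (simp add: sum.reindex is_basis_def coord_def)
qed

lemma br_basis:
  fixes E :: "'n::finite \<Rightarrow> 'g::real_vector"
  assumes "is_basis E"
  shows "br (E i) (E j) = (\<Sum>k\<in>UNIV. struct_const br E i j k *\<^sub>R E k)"
  using basis_expansion[OF assms] by (simp add: struct_const_def)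

lemma anchor_T0:
  assumes "lie_algebra br"
  shows "anchor br p (T0 p) = (1, 0)"
  by (cases p) (simp add: T0_def lie_algebra_bilin_simps[OF assms])

lemma anchor_ee:
  fixes E :: "'n::finite \<Rightarrow> 'g::real_normed_vector"
  assumes "lie_algebra br" "is_basis E"
  shows "anchor br p (ee E i p)
    = (\<Sum>j\<in>UNIV. (\<Sum>k\<in>UNIV. coord E k (snd p) * struct_const br E k i j) *\<^sub>R (0, E j))"
proof -
  have "br (snd p) (E i) = br (\<Sum>k\<in>UNIV. coord E k (snd p) *\<^sub>R E k) (E i)"
    by (simp add: basis_expansion[OF assms(2)])
  also have "\<dots> = (\<Sum>k\<in>UNIV. coord E k (snd p) *\<^sub>R br (E k) (E i))"
    by (simp add: linear_sum[OF lie_algebra_linear(2)[OF assms(1)]]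
        lie_algebra_bilin_simps[OF assms(1)])
  also have "\<dots> = (\<Sum>k\<in>UNIV. \<Sum>j\<in>UNIV. (coord E k (snd p) * struct_const br E k i j) *\<^sub>R E j)"
    by (simp add: br_basis[OF assms(2)] scaleR_sum_right)
  also have "\<dots> = (\<Sum>j\<in>UNIV. (\<Sum>k\<in>UNIV. coord E k (snd p) * struct_const br E k i j) *\<^sub>R E j)"
    by (subst sum.swap) (simp add: scaleR_sum_left)
  finally show ?thesis
    by (cases p) (simp add: ee_def sum_prod)
qed

lemma anchor_We:
  assumes "lie_algebra br"
  shows "anchor br p (We E i p) = (0, E i)"
  by (cases p) (simp add: We_def lie_algebra_bilin_simps[OF assms])

lemma bracket_frame:
  fixes E :: "'n::finite \<Rightarrow> 'g::real_normed_vector"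
  assumes "lie_algebra br" "is_basis E"
  shows "bracket br T0 (ee E i) = (\<lambda>p. 0)"
    and "bracket br T0 (We E i) = (\<lambda>p. 0)"
    and "bracket br (ee E i) (ee E j) = (\<lambda>p. \<Sum>k\<in>UNIV. struct_const br E i j k *\<^sub>R ee E k p)"
    and "bracket br (ee E i) (We E j) = (\<lambda>p. \<Sum>k\<in>UNIV. struct_const br E i j k *\<^sub>R We E k p)"
    and "bracket br (We E i) (We E j) = (\<lambda>p. 0)"
  by (simp_all add: bracket_def anchor_deriv_def T0_def ee_def We_def sum_prod
      lie_algebra_bilin_simps[OF assms(1)] br_basis[OF assms(2)] zero_prod_def)

lemma bracket_skew:
  assumes "lie_algebra br"
  shows "bracket br \<sigma>1 \<sigma>2 p = - bracket br \<sigma>2 \<sigma>1 p"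
proof -
  have "fibre_bracket br x y = - fibre_bracket br y x" for x y
    by (cases x; cases y) (simp add: lie_algebra_skew[OF assms, symmetric])
  from this[of "\<sigma>1 p" "\<sigma>2 p"] show ?thesis
    by (simp add: bracket_def)
qed

lemma anchor_add:
  assumes "lie_algebra br"
  shows "anchor br p (x + y) = anchor br p x + anchor br p y"
  by (cases p; cases x; cases y) (simp add: lie_algebra_bilin_simps[OF assms])

lemma anchor_scaleR:
  assumes "lie_algebra br"
  shows "anchor br p (c *\<^sub>R x) = c *\<^sub>R anchor br p x"
  by (cases p; cases x) (simp add: lie_algebra_bilin_simps[OF assms] scaleR_add_right)

lemma bracket_add:
  assumes "lie_algebra br" "\<sigma> differentiable (at p)"
    "\<sigma>1 differentiable (at p)" "\<sigma>2 differentiable (at p)"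
  shows "bracket br \<sigma> (\<lambda>q. \<sigma>1 q + \<sigma>2 q) p = bracket br \<sigma> \<sigma>1 p + bracket br \<sigma> \<sigma>2 p"
proof -
  have d: "frechet_derivative (\<lambda>q. \<sigma>1 q + \<sigma>2 q) (at p)
      = (\<lambda>v. frechet_derivative \<sigma>1 (at p) v + frechet_derivative \<sigma>2 (at p) v)"
    using assms(3,4) by (intro frechet_derivative_at[symmetric] has_derivative_add)
      (auto simp: frechet_derivative_works)
  have f: "fibre_bracket br x (y + z) = fibre_bracket br x y + fibre_bracket br x z" for x y z
    by (cases x; cases y; cases z) (simp add: lie_algebra_bilin_simps[OF assms(1)])
  have l: "frechet_derivative \<sigma> (at p) (x + y)
      = frechet_derivative \<sigma> (at p) x + frechet_derivative \<sigma> (at p) y" for x y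
    using linear_add[OF linear_frechet_derivative[OF assms(2)]] .
  show ?thesis
    by (simp add: bracket_def anchor_deriv_def d f l anchor_add[OF assms(1)])
qed

lemma bracket_Leibniz:
  assumes "lie_algebra br" "\<sigma>1 differentiable (at p)" "\<sigma>2 differentiable (at p)"
    "f differentiable (at p)"
  shows "bracket br \<sigma>1 (\<lambda>q. f q *\<^sub>R \<sigma>2 q) p
    = anchor_deriv br \<sigma>1 f p *\<^sub>R \<sigma>2 p + f p *\<^sub>R bracket br \<sigma>1 \<sigma>2 p"
proof -
  have d: "frechet_derivative (\<lambda>q. f q *\<^sub>R \<sigma>2 q) (at p)
      = (\<lambda>v. f p *\<^sub>R frechet_derivative \<sigma>2 (at p) v + frechet_derivative f (at p) v *\<^sub>R \<sigma>2 p)"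
    using assms(3,4) by (intro frechet_derivative_at[symmetric] has_derivative_scaleR)
      (auto simp: frechet_derivative_works)
  have b: "fibre_bracket br x (c *\<^sub>R y) = c *\<^sub>R fibre_bracket br x y" for x y c
    by (cases x; cases y) (simp add: lie_algebra_bilin_simps[OF assms(1)] scaleR_add_right)
  have l: "frechet_derivative \<sigma>1 (at p) (c *\<^sub>R x) = c *\<^sub>R frechet_derivative \<sigma>1 (at p) x" for c x
    using linear_scale[OF linear_frechet_derivative[OF assms(2)]] .
  show ?thesis
    by (simp add: bracket_def anchor_deriv_def d b l anchor_scaleR[OF assms(1)]
        scaleR_add_right scaleR_diff_right)
qed

section \<open>Forms on the Lie algebroid\<close>

text \<open>A \<open>q\<close>-form assigns to each point an alternating multilinear function of \<open>q\<close> elements of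
  the fibre, given as a list; only its values on lists of length \<open>q\<close> are relevant. Smoothness
  is tested on constant arguments, that is, on the components of the form.\<close>

type_synonym 'g form = "real \<times> 'g \<Rightarrow> 'g fibre list \<Rightarrow> real"

definition alternating_multilinear :: "nat \<Rightarrow> ('v::real_vector list \<Rightarrow> real) \<Rightarrow> bool" where
  "alternating_multilinear q a \<longleftrightarrow>
     (\<forall>vs i. length vs = q \<and> i < q \<longrightarrow> linear (\<lambda>v. a (vs[i := v]))) \<and>
     (\<forall>vs. length vs = q \<and> \<not> distinct vs \<longrightarrow> a vs = 0)"

definition is_form :: "nat \<Rightarrow> ('g::real_normed_vector) form \<Rightarrow> bool" where
  "is_form q \<omega> \<longleftrightarrow> (\<forall>p. alternating_multilinear q (\<omega> p)) \<and>
     (\<forall>vs. length vs = q \<longrightarrow> smooth (\<lambda>p. \<omega> p vs))"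

definition eval_form :: "'g form \<Rightarrow> 'g sect list \<Rightarrow> real \<times> 'g \<Rightarrow> real" where
  "eval_form \<omega> \<sigma>s = (\<lambda>p. \<omega> p (map (\<lambda>\<sigma>. \<sigma> p) \<sigma>s))"

definition interior_product :: "'g sect \<Rightarrow> 'g form \<Rightarrow> 'g form" where
  "interior_product \<sigma> \<omega> = (\<lambda>p vs. \<omega> p (\<sigma> p # vs))"

definition wedge :: "nat \<Rightarrow> nat \<Rightarrow> 'g form \<Rightarrow> 'g form \<Rightarrow> 'g form" where
  "wedge p q \<alpha> \<beta> = (\<lambda>x vs. (\<Sum>\<pi> | \<pi> permutes {..<p + q}.
      real_of_int (sign \<pi>) * \<alpha> x (map (\<lambda>i. vs ! \<pi> i) [0..<p])
                            * \<beta> x (map (\<lambda>i. vs ! \<pi> i) [p..<p + q])) / (fact p * fact q))"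

text \<open>The \<open>k\<close>-fold wedge product of a two-form with itself, a form of degree \<open>2 * k\<close>.\<close>

primrec wedge_power :: "'g form \<Rightarrow> nat \<Rightarrow> 'g form" where
  "wedge_power \<Omega> 0 = (\<lambda>p vs. 1)"
| "wedge_power \<Omega> (Suc k) = wedge 2 (2 * k) \<Omega> (wedge_power \<Omega> k)"

definition form_zero_at :: "nat \<Rightarrow> 'g form \<Rightarrow> real \<times> 'g \<Rightarrow> bool" where
  "form_zero_at q \<omega> p \<longleftrightarrow> (\<forall>vs. length vs = q \<longrightarrow> \<omega> p vs = 0)"

text \<open>\<open>ext_deriv br \<omega> [\<sigma>\<^sub>0, \<dots>, \<sigma>\<^sub>q]\<close> is $\delta\omega(\sigma_0, \dots, \sigma_q)$. Positions are
  counted from \<open>0\<close>, hence the sign \<open>(- 1) ^ i\<close> in the first sum.\<close>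

definition ext_deriv :: "('g::real_normed_vector \<Rightarrow> 'g \<Rightarrow> 'g) \<Rightarrow> 'g form \<Rightarrow>
    'g sect list \<Rightarrow> real \<times> 'g \<Rightarrow> real" where
  "ext_deriv br \<omega> \<sigma>s = (\<lambda>p.
     (\<Sum>i<length \<sigma>s. (- 1) ^ i *
        anchor_deriv br (\<sigma>s ! i) (eval_form \<omega> (nths \<sigma>s (- {i}))) p) +
     (\<Sum>j<length \<sigma>s. \<Sum>i<j. (- 1) ^ (i + j) *
        eval_form \<omega> (bracket br (\<sigma>s ! i) (\<sigma>s ! j) # nths \<sigma>s (- {i, j})) p))"

text \<open>\<open>\<delta>\<omega> = 0\<close> for a \<open>q\<close>-form \<open>\<omega>\<close>.\<close>

definition form_closed :: "('g::real_normed_vector \<Rightarrow> 'g \<Rightarrow> 'g) \<Rightarrow> nat \<Rightarrow> 'g form \<Rightarrow> bool" where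
  "form_closed br q \<omega> \<longleftrightarrow>
     (\<forall>\<sigma>s. length \<sigma>s = Suc q \<and> (\<forall>\<sigma>\<in>set \<sigma>s. smooth \<sigma>) \<longrightarrow> (\<forall>p. ext_deriv br \<omega> \<sigma>s p = 0))"

end

theory Submission
  imports Defs
begin

text \<open>Put \<open>H\<^sub>i = e\<^sub>i - \<lambda>\<^sub>i\<^sup>k W\<^sub>k\<close>. The coefficients of the multiplier equations are the brackets
  \<open>[\<Gamma>\<^sub>0, W\<^sub>i] = - H\<^sub>i + \<lambda>\<^sub>i\<^sup>k W\<^sub>k\<close> and \<open>[\<Gamma>\<^sub>0, H\<^sub>i] = \<lambda>\<^sub>i\<^sup>k H\<^sub>k + \<phi>\<^sub>i\<^sup>k W\<^sub>k\<close>. For a two-form with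
  \<open>\<Omega>(\<Gamma>\<^sub>0, _) = 0\<close> and \<open>\<Omega>(W\<^sub>i, W\<^sub>j) = 0\<close> put \<open>k\<^sub>i\<^sub>j = \<Omega>(W\<^sub>i, e\<^sub>j)\<close>. Evaluating \<open>\<delta>\<Omega>\<close> on
  \<open>(\<Gamma>\<^sub>0, W, W)\<close>, \<open>(\<Gamma>\<^sub>0, W, H)\<close>, \<open>(\<Gamma>\<^sub>0, H, H)\<close> and \<open>(W, W, H)\<close> gives exactly the multiplier
  equations for \<open>k\<close> together with \<open>\<Omega>(H\<^sub>i, H\<^sub>j) = 0\<close>. The remaining components of \<open>\<delta>\<Omega>\<close> vanish
  automatically: \<open>\<delta>\<delta>\<Omega> = 0\<close> and \<open>\<delta>\<Omega>(\<Gamma>\<^sub>0, _, _) = 0\<close> make \<open>\<delta>\<Omega>\<close> invariant under \<open>\<Gamma>\<^sub>0\<close>. The form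
  \<open>\<Omega>\<close> has rank \<open>2 n\<close> iff \<open>k\<close> is invertible.

  Everything is computed on constant sections, which form a Lie algebra acting on functions
  through the anchor; the derivative of a two-form is tensorial, so they suffice.\<close>

section \<open>Calculus of smooth functions\<close>

lemma Ck_Suc_imp_Ck: "Ck (Suc k) f \<Longrightarrow> Ck k f"
proof (induction k arbitrary: f)
  case 0
  then show ?case
    by (auto simp: continuous_on_eq_continuous_at differentiable_imp_continuous_within)
next
  case (Suc k)
  then show ?case by (metis Ck.simps(2))
qed

lemma Ck_const: "Ck k (\<lambda>x. c)"
  by (induction k arbitrary: c) auto

lemma Ck_add:
  assumes "Ck k f" "Ck k g"
  shows "Ck k (\<lambda>x. f x + g x)"
  using assms
proof (induction k arbitrary: f g)
  case 0
  then show ?case by (auto intro: continuous_intros)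
next
  case (Suc k)
  have "frechet_derivative (\<lambda>x. f x + g x) (at x) v
      = frechet_derivative f (at x) v + frechet_derivative g (at x) v" for x v
    using Suc.prems by (subst frechet_derivative_at[symmetric, OF has_derivative_add])
      (auto simp: frechet_derivative_works)
  with Suc show ?case by auto
qed

text \<open>The product rule turns a directional derivative into a sum of two expressions of the
  same bilinear shape, so the induction closes under addition. Real products, scalar multiples and
  inner products are all instances.\<close>

lemma Ck_bilinear:
  assumes "bounded_bilinear prd" "Ck k f" "Ck k g"
  shows "Ck k (\<lambda>x. prd (f x) (g x))"
  using assms(2,3)
proof (induction k arbitrary: f g)
  case 0
  then show ?case using bounded_bilinear.continuous_on[OF assms(1)] by auto
next
  case (Suc k)
  have d: "((\<lambda>x. prd (f x) (g x)) has_derivative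
      (\<lambda>v. prd (f x) (frechet_derivative g (at x) v) + prd (frechet_derivative f (at x) v) (g x))) (at x)" for x
    using Suc.prems by (intro bounded_bilinear.FDERIV[OF assms(1)])
      (auto simp: frechet_derivative_works)
  have "Ck k f" "Ck k g" using Suc.prems Ck_Suc_imp_Ck by blast+
  with Suc show ?case
    by (auto simp: frechet_derivative_at[OF d, symmetric] differentiable_def intro: d intro!: Ck_add)
qed

lemma smooth_const [simp]: "smooth (\<lambda>x. c)"
  by (simp add: smooth_def Ck_const)

lemma smooth_add: "smooth f \<Longrightarrow> smooth g \<Longrightarrow> smooth (\<lambda>x. f x + g x)"
  by (simp add: smooth_def Ck_add)

lemma smooth_bilinear:
  "bounded_bilinear prd \<Longrightarrow> smooth f \<Longrightarrow> smooth g \<Longrightarrow> smooth (\<lambda>x. prd (f x) (g x))"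
  by (simp add: smooth_def Ck_bilinear)

lemmas smooth_mult = smooth_bilinear[OF bounded_bilinear_mult]
lemmas smooth_scaleR = smooth_bilinear[OF bounded_bilinear_scaleR]

lemma smooth_uminus: "smooth f \<Longrightarrow> smooth (\<lambda>x. - f x)"
  using smooth_scaleR[OF smooth_const[of "-1"], of f] by simp

lemma smooth_diff: "smooth f \<Longrightarrow> smooth g \<Longrightarrow> smooth (\<lambda>x. f x - g x)"
  using smooth_add[OF _ smooth_uminus, of f g] by simp

lemma smooth_sum: "(\<And>i. i \<in> I \<Longrightarrow> smooth (f i)) \<Longrightarrow> smooth (\<lambda>x. \<Sum>i\<in>I. f i x)"
  by (induction I rule: infinite_finite_induct) (auto intro: smooth_add)

text \<open>The derivative in direction \<open>v\<close> is the constant \<open>L v\<close>, so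
  beyond order zero only constants remain.\<close>

lemma smooth_bounded_linear:
  assumes "bounded_linear L"
  shows "smooth L"
  unfolding smooth_def
proof
  fix k
  have "frechet_derivative L (at x) v = L v" for x v
    by (metis assms frechet_derivative_at bounded_linear_imp_has_derivative)
  moreover have "L differentiable at x" for x
    using assms bounded_linear_imp_differentiable by blast
  ultimately show "Ck k L"
    using assms by (cases k) (auto simp: Ck_const linear_continuous_on)
qed

lemma smooth_linear:
  fixes L :: "'a::euclidean_space \<Rightarrow> 'b::real_normed_vector"
  shows "linear L \<Longrightarrow> smooth L"
  by (simp add: smooth_bounded_linear linear_conv_bounded_linear)

lemma smooth_imp_differentiable: "smooth f \<Longrightarrow> f differentiable (at x)"
  unfolding smooth_def using Ck.simps(2) by blast

lemma smooth_has_derivative: "smooth f \<Longrightarrow> (f has_derivative frechet_derivative f (at x)) (at x)"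
  using smooth_imp_differentiable frechet_derivative_works by blast

lemma smooth_directional: "smooth f \<Longrightarrow> smooth (\<lambda>x. frechet_derivative f (at x) v)"
  unfolding smooth_def using Ck.simps(2) by blast

lemma smooth_imp_continuous: "smooth f \<Longrightarrow> isCont f x"
  using smooth_imp_differentiable differentiable_imp_continuous_within by blast

section \<open>Linear maps depending on a point, applied to varying arguments\<close>

lemma linear_expand_Basis:
  fixes L :: "'a::euclidean_space \<Rightarrow> 'b::real_vector"
  assumes "linear L"
  shows "L v = (\<Sum>b\<in>Basis. (v \<bullet> b) *\<^sub>R L b)"
proof -
  have "L v = L (\<Sum>b\<in>Basis. (v \<bullet> b) *\<^sub>R b)" by (simp add: euclidean_representation)
  then show ?thesis by (simp add: linear_sum[OF assms] linear_scale[OF assms])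
qed

text \<open>\<open>smooth\<close> speaks of derivatives in a fixed direction only. Expanding
  \<open>V x\<close> in the finite \<open>Basis\<close> reduces a varying direction to fixed ones
  with smooth coefficients.\<close>

lemma smooth_derivative_along:
  fixes f :: "'a::euclidean_space \<Rightarrow> 'b::real_normed_vector"
  assumes "smooth f" "smooth V"
  shows "smooth (\<lambda>x. frechet_derivative f (at x) (V x))"
proof -
  have "frechet_derivative f (at x) (V x)
      = (\<Sum>b\<in>Basis. (V x \<bullet> b) *\<^sub>R frechet_derivative f (at x) b)" for x
    by (intro linear_expand_Basis linear_frechet_derivative smooth_imp_differentiable assms)
  then show ?thesis
    by (auto intro!: smooth_sum smooth_scaleR smooth_directional assms
        smooth_bilinear[OF bounded_bilinear_inner])
qed

text \<open>A product rule for evaluation. Forms are only known to be differentiable on constant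
  arguments, so \<open>F q\<close> is expanded over \<open>Basis\<close>, whose elements are
  constant arguments.\<close>

lemma has_derivative_apply_linear:
  fixes F :: "'a::real_normed_vector \<Rightarrow> 'v::euclidean_space \<Rightarrow> 'b::real_normed_vector"
  assumes lin: "\<And>q. linear (F q)"
    and diff: "\<And>x. (\<lambda>q. F q x) differentiable (at p)"
    and s: "s differentiable (at p)"
  shows "((\<lambda>q. F q (s q)) has_derivative
    (\<lambda>v. frechet_derivative (\<lambda>q. F q (s p)) (at p) v + F p (frechet_derivative s (at p) v))) (at p)"
proof -
  have e: "F q x = (\<Sum>b\<in>Basis. (x \<bullet> b) *\<^sub>R F q b)" for q x
    by (rule linear_expand_Basis[OF lin])
  have df: "((\<lambda>q. F q x) has_derivative frechet_derivative (\<lambda>q. F q x) (at p)) (at p)" for x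
    using diff frechet_derivative_works by blast
  have ds: "(s has_derivative frechet_derivative s (at p)) (at p)"
    using s frechet_derivative_works by blast
  \<comment> \<open>With the argument frozen at \<open>s p\<close>, this is the first of the two
    terms of the product rule.\<close>
  have "((\<lambda>q. \<Sum>b\<in>Basis. (s p \<bullet> b) *\<^sub>R F q b) has_derivative
      (\<lambda>v. \<Sum>b\<in>Basis. (s p \<bullet> b) *\<^sub>R frechet_derivative (\<lambda>q. F q b) (at p) v)) (at p)"
    by (intro has_derivative_sum has_derivative_scaleR_right df)
  then have d1: "frechet_derivative (\<lambda>q. F q (s p)) (at p)
      = (\<lambda>v. \<Sum>b\<in>Basis. (s p \<bullet> b) *\<^sub>R frechet_derivative (\<lambda>q. F q b) (at p) v)"
    unfolding e[symmetric] by (rule frechet_derivative_at[symmetric])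
  have "((\<lambda>q. \<Sum>b\<in>Basis. (s q \<bullet> b) *\<^sub>R F q b) has_derivative
      (\<lambda>v. \<Sum>b\<in>Basis. (s p \<bullet> b) *\<^sub>R frechet_derivative (\<lambda>q. F q b) (at p) v
         + (frechet_derivative s (at p) v \<bullet> b) *\<^sub>R F p b)) (at p)"
    by (intro has_derivative_sum has_derivative_scaleR has_derivative_inner_left ds df)
  then show ?thesis
    unfolding e[symmetric] sum.distrib d1 .
qed

text \<open>The mean value theorem is applied twice: in direction \<open>u\<close> to the difference
  of \<open>f\<close> along two parallel segments, then in direction \<open>v\<close> to the
  derivative \<open>fu\<close>.\<close>

lemma mixed_difference_mvt:
  fixes f :: "'a::real_normed_vector \<Rightarrow> real"
  assumes f: "smooth f" and h: "h > 0"
  shows "\<exists>\<xi> \<eta>. 0 < \<xi> \<and> \<xi> < h \<and> 0 < \<eta> \<and> \<eta> < h \<and>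
    f (x + h *\<^sub>R u + h *\<^sub>R v) - f (x + h *\<^sub>R u) - f (x + h *\<^sub>R v) + f x
      = h * h * frechet_derivative (\<lambda>y. frechet_derivative f (at y) u) (at (x + \<xi> *\<^sub>R u + \<eta> *\<^sub>R v)) v"
proof -
  define fu where "fu = (\<lambda>y. frechet_derivative f (at y) u)"
  have fu: "smooth fu" unfolding fu_def by (rule smooth_directional[OF f])
  have along: "((\<lambda>s. g (y + s *\<^sub>R w)) has_real_derivative frechet_derivative g (at (y + s *\<^sub>R w)) w) (at s)"
    if g: "smooth g" for g :: "'a \<Rightarrow> real" and y w s
  proof -
    have "((\<lambda>s. g (y + s *\<^sub>R w)) has_derivative
        (\<lambda>r. frechet_derivative g (at (y + s *\<^sub>R w)) (r *\<^sub>R w))) (at s)"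
      by (rule has_derivative_compose[OF _ smooth_has_derivative[OF g]])
        (auto intro!: derivative_eq_intros)
    moreover have "frechet_derivative g (at (y + s *\<^sub>R w)) (r *\<^sub>R w)
        = frechet_derivative g (at (y + s *\<^sub>R w)) w * r" for r
      by (simp add: linear_scale[OF linear_frechet_derivative[OF smooth_imp_differentiable[OF g]]])
    ultimately show ?thesis by (simp add: has_field_derivative_def)
  qed
  have "((\<lambda>s. f ((x + h *\<^sub>R v) + s *\<^sub>R u) - f (x + s *\<^sub>R u)) has_real_derivative
      fu ((x + h *\<^sub>R v) + s *\<^sub>R u) - fu (x + s *\<^sub>R u)) (at s)" for s
    unfolding fu_def by (intro DERIV_diff along f)
  from MVT2[OF h this] obtain \<xi> where \<xi>: "0 < \<xi>" "\<xi> < h"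
    "f ((x + h *\<^sub>R v) + h *\<^sub>R u) - f (x + h *\<^sub>R u) - (f (x + h *\<^sub>R v) - f x)
      = h * (fu ((x + h *\<^sub>R v) + \<xi> *\<^sub>R u) - fu (x + \<xi> *\<^sub>R u))"
    by auto
  from MVT2[OF h along[OF fu, of "x + \<xi> *\<^sub>R u" v]] obtain \<eta> where \<eta>: "0 < \<eta>" "\<eta> < h"
    "fu (x + \<xi> *\<^sub>R u + h *\<^sub>R v) - fu (x + \<xi> *\<^sub>R u)
      = h * frechet_derivative fu (at (x + \<xi> *\<^sub>R u + \<eta> *\<^sub>R v)) v"
    by auto
  show ?thesis
    using \<xi> \<eta> by (intro exI[of _ \<xi>] exI[of _ \<eta>]) (simp add: fu_def algebra_simps)
qed

text \<open>The second difference quotient \<open>Q\<close> is symmetric in \<open>u\<close> and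
  \<open>v\<close>. By the mean value form and continuity it converges to either mixed derivative,
  so the two limits agree.\<close>

lemma second_derivative_symmetric:
  fixes f :: "'a::real_normed_vector \<Rightarrow> real"
  assumes f: "smooth f"
  shows "frechet_derivative (\<lambda>y. frechet_derivative f (at y) u) (at x) v
       = frechet_derivative (\<lambda>y. frechet_derivative f (at y) v) (at x) u"
proof -
  define h where "h n = inverse (real (Suc n))" for n
  have h: "h n > 0" for n by (simp add: h_def)
  have h0: "h \<longlonglongrightarrow> 0" unfolding h_def by (rule LIMSEQ_inverse_real_of_nat)
  define Q where "Q u v n = (f (x + h n *\<^sub>R u + h n *\<^sub>R v) - f (x + h n *\<^sub>R u)
      - f (x + h n *\<^sub>R v) + f x) / (h n * h n)" for u v n
  have lim: "Q u v \<longlonglongrightarrow> frechet_derivative (\<lambda>y. frechet_derivative f (at y) u) (at x) v" for u v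
  proof -
    let ?g = "\<lambda>y. frechet_derivative (\<lambda>y. frechet_derivative f (at y) u) (at y) v"
    have "\<exists>\<xi> \<eta>. 0 < \<xi> \<and> \<xi> < h n \<and> 0 < \<eta> \<and> \<eta> < h n \<and> Q u v n = ?g (x + \<xi> *\<^sub>R u + \<eta> *\<^sub>R v)" for n
      using mixed_difference_mvt[OF f h, of n x u v] h[of n] unfolding Q_def by fastforce
    then obtain \<xi> \<eta> where b: "\<And>n. 0 < \<xi> n" "\<And>n. \<xi> n < h n" "\<And>n. 0 < \<eta> n" "\<And>n. \<eta> n < h n"
      and q: "\<And>n. Q u v n = ?g (x + \<xi> n *\<^sub>R u + \<eta> n *\<^sub>R v)" by metis
    have "\<xi> \<longlonglongrightarrow> 0" "\<eta> \<longlonglongrightarrow> 0"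
      using b by (auto intro!: tendsto_sandwich[OF _ _ tendsto_const h0] always_eventually less_imp_le)
    then have "(\<lambda>n. x + \<xi> n *\<^sub>R u + \<eta> n *\<^sub>R v) \<longlonglongrightarrow> x + 0 *\<^sub>R u + 0 *\<^sub>R v"
      by (intro tendsto_intros)
    moreover have "isCont ?g x"
      by (intro smooth_imp_continuous smooth_directional f)
    ultimately show ?thesis
      using isCont_tendsto_compose[of x ?g] by (simp add: q[abs_def])
  qed
  have "Q u v = Q v u" by (auto simp: Q_def algebra_simps)
  then show ?thesis using lim[of u v] lim[of v u] LIMSEQ_unique by metis
qed

section \<open>The exterior derivative of a two-form on constant sections\<close>

lemma fibre_bracket_skew:
  assumes "lie_algebra br"
  shows "fibre_bracket br x y = - fibre_bracket br y x"
  by (cases x; cases y) (simp add: lie_algebra_skew[OF assms, symmetric])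

lemma linear_fibre_bracket:
  assumes "lie_algebra br"
  shows "linear (fibre_bracket br x)" "linear (\<lambda>x. fibre_bracket br x y)"
proof -
  have *: "linear (fibre_bracket br x)" for x
  proof (rule linearI)
    show "fibre_bracket br x (a + b) = fibre_bracket br x a + fibre_bracket br x b" for a b
      by (cases x; cases a; cases b) (simp add: lie_algebra_bilin_simps[OF assms])
    show "fibre_bracket br x (c *\<^sub>R a) = c *\<^sub>R fibre_bracket br x a" for c a
      by (cases x; cases a) (simp add: lie_algebra_bilin_simps[OF assms] scaleR_add_right)
  qed
  then show "linear (fibre_bracket br x)" .
  have "linear (\<lambda>x. - fibre_bracket br y x)"
    using * by (rule linear_compose_neg)
  then show "linear (\<lambda>x. fibre_bracket br x y)"
    by (subst fibre_bracket_skew[OF assms])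
qed

lemma lie_algebra_Jacobi:
  assumes "lie_algebra br"
  shows "br (br x y) z = br (br x z) y + br x (br y z)"
proof -
  have "br x (br y z) + br y (br z x) + br z (br x y) = 0"
    using assms by (auto simp: lie_algebra_def)
  moreover have "br y (br z x) = br (br x z) y"
    using lie_algebra_skew[OF assms, of y] lie_algebra_skew[OF assms, of z x]
    by (simp add: lie_algebra_bilin_simps[OF assms])
  moreover have "br z (br x y) = - br (br x y) z"
    using lie_algebra_skew[OF assms, of z] by simp
  ultimately show ?thesis by (simp add: algebra_simps)
qed

text \<open>The fibre is the direct sum of a central line and the semidirect product of the Lie
  algebra with its adjoint representation. The last component is the sum of three Jacobi identities,
  each with one \<open>v\<close> and two \<open>u\<close> entries.\<close>

lemma fibre_bracket_Jacobi:
  assumes "lie_algebra br"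
  shows "fibre_bracket br (fibre_bracket br x y) z
    = fibre_bracket br (fibre_bracket br x z) y + fibre_bracket br x (fibre_bracket br y z)"
proof -
  obtain a1 u1 v1 a2 u2 v2 a3 u3 v3
    where [simp]: "x = (a1, u1, v1)" "y = (a2, u2, v2)" "z = (a3, u3, v3)"
    by (metis prod_cases3)
  have *: "br (br a b) c = br (br a c) b + br a (br b c)" for a b c
    by (rule lie_algebra_Jacobi[OF assms])
  show ?thesis
    using *[of u1 u2 u3] *[of u1 u2 v3] *[of u1 v2 u3] *[of v1 u2 u3]
    by (simp add: lie_algebra_bilin_simps[OF assms])
qed

text \<open>The action of the constant section \<open>x\<close> on \<open>f\<close>, taken at
  \<open>p\<close>. As it is pointwise in \<open>x\<close>, it also gives the action of any section
  \<open>\<sigma>\<close> by putting \<open>x = \<sigma> p\<close>.\<close>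

definition lie_der :: "('g::real_normed_vector \<Rightarrow> 'g \<Rightarrow> 'g) \<Rightarrow> (real \<times> 'g \<Rightarrow> real) \<Rightarrow> real \<times> 'g \<Rightarrow>
    'g fibre \<Rightarrow> real" where
  "lie_der br f p x = frechet_derivative f (at p) (anchor br p x)"

lemma linear_anchor:
  assumes "lie_algebra br"
  shows "linear (anchor br p)"
  by (intro linearI anchor_add anchor_scaleR assms)

lemma linear_lie_der:
  assumes "lie_algebra br" "smooth f"
  shows "linear (lie_der br f p)"
  unfolding lie_der_def
  using linear_compose[OF linear_anchor[OF assms(1)]
      linear_frechet_derivative[OF smooth_imp_differentiable[OF assms(2)]]]
  by (simp add: o_def)

lemma lie_der_add:
  assumes "smooth f" "smooth g"
  shows "lie_der br (\<lambda>q. f q + g q) p x = lie_der br f p x + lie_der br g p x"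
  unfolding lie_der_def
  by (subst frechet_derivative_at[symmetric, OF has_derivative_add])
    (auto intro: smooth_has_derivative assms)

lemma lie_der_diff:
  assumes "smooth f" "smooth g"
  shows "lie_der br (\<lambda>q. f q - g q) p x = lie_der br f p x - lie_der br g p x"
  unfolding lie_der_def
  by (subst frechet_derivative_at[symmetric, OF has_derivative_diff])
    (auto intro: smooth_has_derivative assms)

lemma lie_der_mult:
  assumes "smooth f" "smooth g"
  shows "lie_der br (\<lambda>q. f q * g q) p x = f p * lie_der br g p x + lie_der br f p x * g p"
  unfolding lie_der_def
  by (subst frechet_derivative_at[symmetric, OF has_derivative_mult])
    (auto intro: smooth_has_derivative assms)

lemma lie_der_sum:
  assumes "\<And>i. smooth (f i)"
  shows "lie_der br (\<lambda>q. \<Sum>i\<in>I. f i q) p x = (\<Sum>i\<in>I. lie_der br (f i) p x)"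
  unfolding lie_der_def
  by (subst frechet_derivative_at[symmetric, OF has_derivative_sum])
    (auto intro: smooth_has_derivative assms)

lemma lie_der_const [simp]: "lie_der br (\<lambda>q. c) p x = 0"
  by (simp add: lie_der_def)

lemma anchor_Pair: "anchor br p (a, u, v) = (a, br (snd p) u + v)"
  by (cases p) simp

lemma has_derivative_anchor:
  fixes br :: "'g::euclidean_space \<Rightarrow> 'g \<Rightarrow> 'g"
  assumes "lie_algebra br"
  shows "((\<lambda>q. anchor br q (a, u, v)) has_derivative (\<lambda>h. (0, br (snd h) u))) (at p)"
proof -
  have "bounded_linear (\<lambda>w. br w u)"
    using lie_algebra_linear(2)[OF assms] by (simp add: linear_conv_bounded_linear)
  then have "bounded_linear (\<lambda>h::real \<times> 'g. br (snd h) u)"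
    by (rule bounded_linear_compose[OF _ bounded_linear_snd])
  then show ?thesis
    unfolding anchor_Pair
    by (auto intro!: derivative_eq_intros bounded_linear_imp_has_derivative)
qed

lemma smooth_anchor:
  fixes br :: "'g::euclidean_space \<Rightarrow> 'g \<Rightarrow> 'g"
  assumes "lie_algebra br"
  shows "smooth (\<lambda>q. anchor br q x)"
proof -
  obtain a u v where x: "x = (a, u, v)" by (metis prod_cases3)
  have "linear (\<lambda>q::real \<times> 'g. (0::real, br (snd q) u))"
    by (rule linearI) (simp_all add: lie_algebra_bilin_simps[OF assms])
  from smooth_add[OF smooth_linear[OF this] smooth_const[of "(a, v)"]]
  show ?thesis by (simp add: anchor_Pair x)
qed

lemma smooth_lie_der:
  fixes br :: "'g::euclidean_space \<Rightarrow> 'g \<Rightarrow> 'g"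
  assumes "lie_algebra br" "smooth f"
  shows "smooth (\<lambda>q. lie_der br f q x)"
  unfolding lie_der_def by (intro smooth_derivative_along smooth_anchor assms)

text \<open>The anchor is a homomorphism to vector fields: second derivatives of \<open>f\<close>
  cancel by symmetry, and what remains is the commutator of the affine fields
  \<open>w \<mapsto> br w u + v\<close>.\<close>

lemma lie_der_commutator:
  fixes br :: "'g::euclidean_space \<Rightarrow> 'g \<Rightarrow> 'g"
  assumes lie: "lie_algebra br" and f: "smooth f"
  shows "lie_der br (\<lambda>q. lie_der br f q y) p x - lie_der br (\<lambda>q. lie_der br f q x) p y
    = lie_der br f p (fibre_bracket br x y)"
proof -
  obtain a1 u1 v1 a2 u2 v2 where xy: "x = (a1, u1, v1)" "y = (a2, u2, v2)"
    by (metis prod_cases3)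
  note bil = lie_algebra_bilin_simps[OF lie]
  have lin: "linear (frechet_derivative f (at q))" for q
    by (intro linear_frechet_derivative smooth_imp_differentiable f)
  \<comment> \<open>One term differentiates \<open>f\<close> twice with the vector field frozen at
    \<open>p\<close>, the other differentiates the vector field.\<close>
  have d: "lie_der br (\<lambda>q. lie_der br f q (a, u, v)) p z
     = frechet_derivative (\<lambda>q. frechet_derivative f (at q) (anchor br p (a, u, v))) (at p) (anchor br p z)
       + frechet_derivative f (at p) (0, br (snd (anchor br p z)) u)" for a u v z
  proof -
    have "(\<lambda>q. frechet_derivative f (at q) w) differentiable (at p)" for w
      by (intro smooth_imp_differentiable smooth_directional f)
    then have "((\<lambda>q. frechet_derivative f (at q) (anchor br q (a, u, v))) has_derivative
        (\<lambda>h. frechet_derivative (\<lambda>q. frechet_derivative f (at q) (anchor br p (a, u, v))) (at p) h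
          + frechet_derivative f (at p) (frechet_derivative (\<lambda>q. anchor br q (a, u, v)) (at p) h))) (at p)"
      by (rule has_derivative_apply_linear[OF lin _ smooth_imp_differentiable[OF smooth_anchor[OF lie]]])
    from frechet_derivative_at[OF this, symmetric] show ?thesis
      unfolding lie_der_def frechet_derivative_at[OF has_derivative_anchor[OF lie], symmetric] by simp
  qed
  have "lie_der br (\<lambda>q. lie_der br f q y) p x - lie_der br (\<lambda>q. lie_der br f q x) p y
      = frechet_derivative f (at p) (0, br (snd (anchor br p x)) u2)
        - frechet_derivative f (at p) (0, br (snd (anchor br p y)) u1)"
    unfolding xy d using second_derivative_symmetric[OF f] by simp
  also have "\<dots> = frechet_derivative f (at p) (0, br (snd (anchor br p x)) u2 - br (snd (anchor br p y)) u1)"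
    by (simp flip: linear_diff[OF lin])
  \<comment> \<open>The Jacobi identity rewrites the part linear in \<open>snd p\<close>; the
    constant part needs only skew-symmetry.\<close>
  also have "br (snd (anchor br p x)) u2 - br (snd (anchor br p y)) u1
      = br (snd p) (br u1 u2) + (br u1 v2 + br v1 u2)"
    using lie_algebra_Jacobi[OF lie, of "snd p" u1 u2] lie_algebra_skew[OF lie, of v2 u1]
    by (simp add: xy anchor_Pair bil)
  finally show ?thesis
    by (simp add: lie_der_def xy anchor_Pair)
qed

text \<open>The Chevalley-Eilenberg formula for three constant sections: their algebroid bracket is
  again constant, namely \<open>fibre_bracket\<close>. Separating the point from the fibre arguments
  makes tensoriality visible.\<close>

definition delta2 :: "('g::real_normed_vector \<Rightarrow> 'g \<Rightarrow> 'g) \<Rightarrow>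
    (real \<times> 'g \<Rightarrow> 'g fibre \<Rightarrow> 'g fibre \<Rightarrow> real) \<Rightarrow>
    real \<times> 'g \<Rightarrow> 'g fibre \<Rightarrow> 'g fibre \<Rightarrow> 'g fibre \<Rightarrow> real" where
  "delta2 br B p x y z =
     lie_der br (\<lambda>q. B q y z) p x - lie_der br (\<lambda>q. B q x z) p y + lie_der br (\<lambda>q. B q x y) p z
     - B p (fibre_bracket br x y) z + B p (fibre_bracket br x z) y - B p (fibre_bracket br y z) x"

locale smooth_two_form =
  fixes br :: "'g::euclidean_space \<Rightarrow> 'g \<Rightarrow> 'g"
    and B :: "real \<times> 'g \<Rightarrow> 'g fibre \<Rightarrow> 'g fibre \<Rightarrow> real"
  assumes lie: "lie_algebra br"
    and linB: "\<And>p x. linear (B p x)"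
    and skew: "\<And>p x y. B p x y = - B p y x"
    and smoothB: "\<And>x y. smooth (\<lambda>p. B p x y)"
begin

lemma linB_left: "linear (\<lambda>x. B p x y)"
proof -
  have "linear (\<lambda>x. - B p y x)" by (intro linear_compose_neg linB)
  then show ?thesis by (subst skew)
qed

lemmas B_simps = linB[THEN linear_add] linB[THEN linear_diff] linB[THEN linear_scale]
  linB[THEN linear_neg] linB[THEN linear_0] linB[THEN linear_sum]
  linB_left[THEN linear_add] linB_left[THEN linear_diff] linB_left[THEN linear_scale]
  linB_left[THEN linear_neg] linB_left[THEN linear_0] linB_left[THEN linear_sum]

lemma B_self [simp]: "B p x x = 0"
  using skew[of p x x] by simp

lemma has_derivative_B:
  assumes "s differentiable (at p)" "t differentiable (at p)"
  shows "((\<lambda>q. B q (s q) (t q)) has_derivative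
    (\<lambda>v. frechet_derivative (\<lambda>q. B q (s p) (t p)) (at p) v
       + B p (frechet_derivative s (at p) v) (t p) + B p (s p) (frechet_derivative t (at p) v))) (at p)"
proof -
  have s: "((\<lambda>q. B q (s q) x) has_derivative
      (\<lambda>v. frechet_derivative (\<lambda>q. B q (s p) x) (at p) v
         + B p (frechet_derivative s (at p) v) x)) (at p)" for x
    by (rule has_derivative_apply_linear[OF linB_left smooth_imp_differentiable[OF smoothB] assms(1)])
  then have "(\<lambda>q. B q (s q) x) differentiable (at p)" for x
    using differentiable_def by blast
  from has_derivative_apply_linear[OF linB this assms(2)] show ?thesis
    unfolding frechet_derivative_at[OF s, symmetric] by simp
qed

lemma anchor_deriv_B:
  assumes "s differentiable (at p)" "t differentiable (at p)"
  shows "anchor_deriv br \<sigma> (\<lambda>q. B q (s q) (t q)) p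
    = lie_der br (\<lambda>q. B q (s p) (t p)) p (\<sigma> p)
      + B p (anchor_deriv br \<sigma> s p) (t p) + B p (s p) (anchor_deriv br \<sigma> t p)"
  unfolding anchor_deriv_def lie_der_def
    frechet_derivative_at[OF has_derivative_B[OF assms], symmetric] ..

text \<open>Tensoriality: the derivatives of the sections coming from the product rule cancel those
  inside the algebroid brackets, and only values at \<open>p\<close> survive.\<close>

lemma ext_deriv_eq_delta2:
  assumes \<Omega>: "\<And>p x y. \<Omega> p [x, y] = B p x y"
    and sm: "s differentiable (at p)" "t differentiable (at p)" "u differentiable (at p)"
  shows "ext_deriv br \<Omega> [s, t, u] p = delta2 br B p (s p) (t p) (u p)"
proof -
  have "ext_deriv br \<Omega> [s, t, u] p =
      anchor_deriv br s (\<lambda>q. B q (t q) (u q)) p - anchor_deriv br t (\<lambda>q. B q (s q) (u q)) p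
      + anchor_deriv br u (\<lambda>q. B q (s q) (t q)) p - B p (bracket br s t p) (u p)
      + B p (bracket br s u p) (t p) - B p (bracket br t u p) (s p)"
    by (simp add: ext_deriv_def numeral_3_eq_3 numeral_2_eq_2 eval_form_def \<Omega> nths_Cons lessThan_Suc)
  then show ?thesis
    \<comment> \<open>Some cancelling pairs have their arguments in opposite order, so skew-symmetry
      is supplied for them.\<close>
    using skew[of p "s p" "anchor_deriv br _ _ p"] skew[of p "t p" "anchor_deriv br _ _ p"]
    by (simp add: anchor_deriv_B sm bracket_def delta2_def B_simps)
qed

lemma delta2_swap12: "delta2 br B p y x z = - delta2 br B p x y z"
proof -
  have "(\<lambda>q. B q y x) = (\<lambda>q. 0 - B q x y)" by (simp add: skew[of _ y x])
  then have "lie_der br (\<lambda>q. B q y x) p z = - lie_der br (\<lambda>q. B q x y) p z"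
    using lie_der_diff[OF smooth_const smoothB, of br 0 x y] by simp
  then show ?thesis
    by (simp add: delta2_def fibre_bracket_skew[OF lie, of y x] B_simps)
qed

lemma delta2_swap23: "delta2 br B p x z y = - delta2 br B p x y z"
proof -
  have "(\<lambda>q. B q z y) = (\<lambda>q. 0 - B q y z)" by (simp add: skew[of _ z y])
  then have "lie_der br (\<lambda>q. B q z y) p x = - lie_der br (\<lambda>q. B q y z) p x"
    using lie_der_diff[OF smooth_const smoothB, of br 0 y z] by simp
  then show ?thesis
    by (simp add: delta2_def fibre_bracket_skew[OF lie, of z y] B_simps)
qed

lemma linear_delta2_1: "linear (\<lambda>x. delta2 br B p x y z)"
proof (rule linearI)
  note [simp] = B_simps linear_fibre_bracket(2)[OF lie, THEN linear_add]
    linear_fibre_bracket(2)[OF lie, THEN linear_scale]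
    linear_lie_der[OF lie smoothB, THEN linear_add] linear_lie_der[OF lie smoothB, THEN linear_scale]
  show "delta2 br B p (x + x') y z = delta2 br B p x y z + delta2 br B p x' y z" for x x'
    by (simp add: delta2_def lie_der_add smoothB)
  show "delta2 br B p (c *\<^sub>R x) y z = c *\<^sub>R delta2 br B p x y z" for c x
    by (simp add: delta2_def lie_der_mult smoothB algebra_simps)
qed

lemma linear_delta2_2: "linear (\<lambda>x. delta2 br B p y x z)"
  using linear_compose_neg[OF linear_delta2_1] by (subst delta2_swap12)

lemma linear_delta2_3: "linear (delta2 br B p y z)"
proof -
  have "linear (\<lambda>x. - delta2 br B p y x z)" by (intro linear_compose_neg linear_delta2_2)
  moreover have "(\<lambda>x. - delta2 br B p y x z) = delta2 br B p y z"
    by (simp add: fun_eq_iff flip: delta2_swap23[of p y z])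
  ultimately show ?thesis by simp
qed

lemma smooth_delta2: "smooth (\<lambda>p. delta2 br B p x y z)"
  unfolding delta2_def by (intro smooth_add smooth_diff smooth_lie_der lie smoothB)

text \<open>This is the square of the exterior derivative being zero, on constant sections.
  Second-order terms pair up into commutators, first-order terms then match, and zero-order terms
  vanish by Jacobi and skew-symmetry.\<close>

lemma delta2_closed:
  defines "L \<equiv> delta2 br B" and "F \<equiv> fibre_bracket br"
  shows "lie_der br (\<lambda>q. L q x1 x2 x3) p x0 - lie_der br (\<lambda>q. L q x0 x2 x3) p x1
       + lie_der br (\<lambda>q. L q x0 x1 x3) p x2 - lie_der br (\<lambda>q. L q x0 x1 x2) p x3
     = L p (F x0 x1) x2 x3 - L p (F x0 x2) x1 x3 + L p (F x0 x3) x1 x2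
     + L p (F x1 x2) x0 x3 - L p (F x1 x3) x0 x2 + L p (F x2 x3) x0 x1"
proof -
  define dd where "dd f x y = lie_der br (\<lambda>q. lie_der br f q y) p x" for f x y
  have d: "lie_der br (\<lambda>q. L q x y z) p w = dd (\<lambda>q. B q y z) w x - dd (\<lambda>q. B q x z) w y
      + dd (\<lambda>q. B q x y) w z - lie_der br (\<lambda>q. B q (F x y) z) p w
      + lie_der br (\<lambda>q. B q (F x z) y) p w - lie_der br (\<lambda>q. B q (F y z) x) p w" for x y z w
    unfolding L_def F_def dd_def delta2_def
    by (simp add: lie_der_add lie_der_diff smooth_add smooth_diff smooth_lie_der lie smoothB)
  have c: "dd (\<lambda>q. B q x y) z w = dd (\<lambda>q. B q x y) w z + lie_der br (\<lambda>q. B q x y) p (F z w)" for x y z w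
    using lie_der_commutator[OF lie smoothB, of x y w p z] by (simp add: dd_def F_def)
  have jac: "B p (F (F x y) z) w = B p (F (F x z) y) w - B p (F (F y z) x) w" for x y z w
    using fibre_bracket_Jacobi[OF lie, of x y z] fibre_bracket_skew[OF lie, of x "F y z"]
    by (simp add: F_def B_simps)
  define E where "E x y z = lie_der br (\<lambda>q. B q x y) p z" for x y z
  have "dd (\<lambda>q. B q x2 x3) x0 x1 - dd (\<lambda>q. B q x2 x3) x1 x0 = E x2 x3 (F x0 x1)"
    "dd (\<lambda>q. B q x1 x3) x0 x2 - dd (\<lambda>q. B q x1 x3) x2 x0 = E x1 x3 (F x0 x2)"
    "dd (\<lambda>q. B q x1 x2) x0 x3 - dd (\<lambda>q. B q x1 x2) x3 x0 = E x1 x2 (F x0 x3)"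
    "dd (\<lambda>q. B q x0 x3) x1 x2 - dd (\<lambda>q. B q x0 x3) x2 x1 = E x0 x3 (F x1 x2)"
    "dd (\<lambda>q. B q x0 x2) x1 x3 - dd (\<lambda>q. B q x0 x2) x3 x1 = E x0 x2 (F x1 x3)"
    "dd (\<lambda>q. B q x0 x1) x2 x3 - dd (\<lambda>q. B q x0 x1) x3 x2 = E x0 x1 (F x2 x3)"
    by (simp_all add: E_def c[of x2 x3 x0 x1] c[of x1 x3 x0 x2] c[of x1 x2 x0 x3]
        c[of x0 x3 x1 x2] c[of x0 x2 x1 x3] c[of x0 x1 x2 x3])
  then have second_order:
    "dd (\<lambda>q. B q x2 x3) x0 x1 - dd (\<lambda>q. B q x2 x3) x1 x0
     - (dd (\<lambda>q. B q x1 x3) x0 x2 - dd (\<lambda>q. B q x1 x3) x2 x0)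
     + (dd (\<lambda>q. B q x1 x2) x0 x3 - dd (\<lambda>q. B q x1 x2) x3 x0)
     + (dd (\<lambda>q. B q x0 x3) x1 x2 - dd (\<lambda>q. B q x0 x3) x2 x1)
     - (dd (\<lambda>q. B q x0 x2) x1 x3 - dd (\<lambda>q. B q x0 x2) x3 x1)
     + (dd (\<lambda>q. B q x0 x1) x2 x3 - dd (\<lambda>q. B q x0 x1) x3 x2)
     = E x2 x3 (F x0 x1) - E x1 x3 (F x0 x2) + E x1 x2 (F x0 x3)
     + E x0 x3 (F x1 x2) - E x0 x2 (F x1 x3) + E x0 x1 (F x2 x3)"
    by (simp only:)
  \<comment> \<open>The first four equations are Jacobi identities, one for each triple of sections;
    the last three are skew-symmetry of \<open>B\<close> on two brackets.\<close>
  have zero_order: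
    "B p (F (F x0 x1) x2) x3 - B p (F (F x0 x2) x1) x3 + B p (F (F x1 x2) x0) x3 = 0"
    "B p (F (F x0 x1) x3) x2 - B p (F (F x0 x3) x1) x2 + B p (F (F x1 x3) x0) x2 = 0"
    "B p (F (F x0 x2) x3) x1 - B p (F (F x0 x3) x2) x1 + B p (F (F x2 x3) x0) x1 = 0"
    "B p (F (F x1 x2) x3) x0 - B p (F (F x1 x3) x2) x0 + B p (F (F x2 x3) x1) x0 = 0"
    "B p (F x2 x3) (F x0 x1) + B p (F x0 x1) (F x2 x3) = 0"
    "B p (F x1 x3) (F x0 x2) + B p (F x0 x2) (F x1 x3) = 0"
    "B p (F x1 x2) (F x0 x3) + B p (F x0 x3) (F x1 x2) = 0"
    using jac[of x0 x1 x2 x3] jac[of x0 x1 x3 x2] jac[of x0 x2 x3 x1] jac[of x1 x2 x3 x0]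
      skew[of p "F x0 x1" "F x2 x3"] skew[of p "F x0 x2" "F x1 x3"] skew[of p "F x0 x3" "F x1 x2"]
    by simp_all
  \<comment> \<open>\<open>S\<close> and \<open>V\<close> are the second- and first-order parts of a
    derivative of \<open>L\<close>; \<open>T\<close> and \<open>U\<close> are the first- and
    zero-order parts of \<open>L\<close>. Naming them splits the identity into three small linear
    ones.\<close>
  define S where "S w x y z = dd (\<lambda>q. B q y z) w x - dd (\<lambda>q. B q x z) w y + dd (\<lambda>q. B q x y) w z"
    for w x y z
  define V where "V w x y z = E (F x y) z w - E (F x z) y w + E (F y z) x w" for w x y z
  define T where "T x y z = E y z x - E x z y + E x y z" for x y z
  define U where "U x y z = B p (F x y) z - B p (F x z) y + B p (F y z) x" for x y z
  have dL: "lie_der br (\<lambda>q. L q x y z) p w = S w x y z - V w x y z" for x y z w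
    unfolding d S_def V_def E_def by simp
  have L: "L p x y z = T x y z - U x y z" for x y z
    unfolding L_def delta2_def T_def U_def E_def F_def by simp
  have "S x0 x1 x2 x3 - S x1 x0 x2 x3 + S x2 x0 x1 x3 - S x3 x0 x1 x2
      = E x2 x3 (F x0 x1) - E x1 x3 (F x0 x2) + E x1 x2 (F x0 x3)
      + E x0 x3 (F x1 x2) - E x0 x2 (F x1 x3) + E x0 x1 (F x2 x3)"
    unfolding S_def using second_order by linarith
  moreover have "T (F x0 x1) x2 x3 - T (F x0 x2) x1 x3 + T (F x0 x3) x1 x2
      + T (F x1 x2) x0 x3 - T (F x1 x3) x0 x2 + T (F x2 x3) x0 x1
      = E x2 x3 (F x0 x1) - E x1 x3 (F x0 x2) + E x1 x2 (F x0 x3)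
      + E x0 x3 (F x1 x2) - E x0 x2 (F x1 x3) + E x0 x1 (F x2 x3)
      - (V x0 x1 x2 x3 - V x1 x0 x2 x3 + V x2 x0 x1 x3 - V x3 x0 x1 x2)"
    unfolding T_def V_def by linarith
  moreover have "U (F x0 x1) x2 x3 - U (F x0 x2) x1 x3 + U (F x0 x3) x1 x2
      + U (F x1 x2) x0 x3 - U (F x1 x3) x0 x2 + U (F x2 x3) x0 x1 = 0"
    unfolding U_def using zero_order by linarith
  ultimately show ?thesis unfolding dL L by linarith
qed

end

text \<open>The algebroid bracket of the section \<open>\<Gamma>\<close> with the constant section
  \<open>y\<close>, at \<open>p\<close>. Its second term accounts for \<open>\<Gamma>\<close> not
  being constant.\<close>

definition relative_bracket :: "('g::real_normed_vector \<Rightarrow> 'g \<Rightarrow> 'g) \<Rightarrow> 'g sect \<Rightarrow> real \<times> 'g \<Rightarrow>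
    'g fibre \<Rightarrow> 'g fibre" where
  "relative_bracket br \<Gamma> p y =
     fibre_bracket br (\<Gamma> p) y - frechet_derivative \<Gamma> (at p) (anchor br p y)"

text \<open>Cartan's formula \<open>L\<^sub>\<Gamma> = \<iota>\<^sub>\<Gamma> \<delta> + \<delta> \<iota>\<^sub>\<Gamma>\<close>, evaluated on constant sections, for a form
  annihilated by \<open>\<Gamma>\<close>.\<close>

context smooth_two_form
begin

lemma delta2_contract:
  assumes \<Gamma>: "smooth \<Gamma>" and ker: "\<And>p y. B p (\<Gamma> p) y = 0"
  shows "delta2 br B p (\<Gamma> p) y z = lie_der br (\<lambda>q. B q y z) p (\<Gamma> p)
    - B p (relative_bracket br \<Gamma> p y) z - B p y (relative_bracket br \<Gamma> p z)"
proof -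
  \<comment> \<open>Differentiating the identity \<open>B q (\<Gamma> q) w = 0\<close> trades a
    derivative of the coefficients of \<open>B\<close> for one of \<open>\<Gamma>\<close>.\<close>
  have "lie_der br (\<lambda>q. B q (\<Gamma> p) w) p x = - B p (frechet_derivative \<Gamma> (at p) (anchor br p x)) w" for w x
  proof -
    have "((\<lambda>q. B q (\<Gamma> q) w) has_derivative (\<lambda>v. frechet_derivative (\<lambda>q. B q (\<Gamma> p) w) (at p) v
        + B p (frechet_derivative \<Gamma> (at p) v) w)) (at p)"
      by (rule has_derivative_apply_linear[where F = "\<lambda>q x. B q x w", OF linB_left])
        (intro smooth_imp_differentiable smoothB \<Gamma>)+
    from frechet_derivative_at[OF this, THEN fun_cong, of "anchor br p x"] show ?thesis
      by (simp only: ker lie_der_def frechet_derivative_const)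
  qed
  moreover have "B p w (\<Gamma> p) = 0" for w using skew[of p w "\<Gamma> p"] ker by simp
  ultimately show ?thesis
    using skew[of p y "fibre_bracket br (\<Gamma> p) z"]
      skew[of p y "frechet_derivative \<Gamma> (at p) (anchor br p z)"]
    by (simp add: delta2_def relative_bracket_def B_simps)
qed

text \<open>Since \<open>\<Gamma>\<close> annihilates the three-form, Cartan's formula leaves only
  the contraction of its exterior derivative, which is zero by \<open>delta2_closed\<close>.\<close>

lemma delta2_invariant:
  assumes \<Gamma>: "smooth \<Gamma>" and ker: "\<And>p y z. delta2 br B p (\<Gamma> p) y z = 0"
  shows "lie_der br (\<lambda>q. delta2 br B q x y z) p (\<Gamma> p) =
    delta2 br B p (relative_bracket br \<Gamma> p x) y z + delta2 br B p x (relative_bracket br \<Gamma> p y) z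
    + delta2 br B p x y (relative_bracket br \<Gamma> p z)"
proof -
  have *: "lie_der br (\<lambda>q. delta2 br B q (\<Gamma> p) w w') p v
      = - delta2 br B p (frechet_derivative \<Gamma> (at p) (anchor br p v)) w w'" for w w' v
  proof -
    have "((\<lambda>q. delta2 br B q (\<Gamma> q) w w') has_derivative
        (\<lambda>v. frechet_derivative (\<lambda>q. delta2 br B q (\<Gamma> p) w w') (at p) v
        + delta2 br B p (frechet_derivative \<Gamma> (at p) v) w w')) (at p)"
      by (rule has_derivative_apply_linear[where F = "\<lambda>q x. delta2 br B q x w w'", OF linear_delta2_1])
        (intro smooth_imp_differentiable smooth_delta2 \<Gamma>)+
    from frechet_derivative_at[OF this, THEN fun_cong, of "anchor br p v"] show ?thesis
      by (simp only: ker lie_der_def frechet_derivative_const)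
  qed
  have k: "delta2 br B p w (\<Gamma> p) w' = 0" for w w'
    using delta2_swap12[of p w "\<Gamma> p" w'] ker by simp
  have s: "delta2 br B p w x y = - delta2 br B p x w y" "delta2 br B p w x y = delta2 br B p x y w" for w x y
    using delta2_swap12[of p w x y] delta2_swap23[of p x w y] by linarith+
  have r: "delta2 br B p (relative_bracket br \<Gamma> p v) w w'
      = delta2 br B p (fibre_bracket br (\<Gamma> p) v) w w'
        - delta2 br B p (frechet_derivative \<Gamma> (at p) (anchor br p v)) w w'" for v w w'
    by (simp add: relative_bracket_def linear_diff[OF linear_delta2_1])
  have e: "delta2 br B p x (relative_bracket br \<Gamma> p y) z = - delta2 br B p (relative_bracket br \<Gamma> p y) x z"
    "delta2 br B p x y (relative_bracket br \<Gamma> p z) = delta2 br B p (relative_bracket br \<Gamma> p z) x y"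
    using s(1)[of "relative_bracket br \<Gamma> p y" x z] s(2)[of "relative_bracket br \<Gamma> p z" x y] by linarith+
  show ?thesis
    unfolding e r using delta2_closed[of x y z p "\<Gamma> p"] unfolding * k by linarith
qed

end

section \<open>Closedness in terms of the reduced multiplier\<close>

lemma linear_coord:
  assumes "is_basis E"
  shows "linear (coord E i)"
  using assms unfolding coord_def is_basis_def
  by (intro linearI) (auto simp: real_vector.representation_add real_vector.representation_scale)

lemma coord_basis:
  assumes "is_basis E"
  shows "coord E i (E j) = (if i = j then 1 else 0)"
proof -
  have "independent (range E)" "inj E" using assms by (auto simp: is_basis_def)
  then show ?thesis
    by (auto simp: coord_def real_vector.representation_basis inj_eq)
qed

locale ip_algebroid =
  fixes br :: "'g::euclidean_space \<Rightarrow> 'g \<Rightarrow> 'g"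
    and E :: "'n::finite \<Rightarrow> 'g"
    and \<gamma> :: "'n \<Rightarrow> real \<times> 'g \<Rightarrow> real"
  assumes lie_br: "lie_algebra br"
    and basis: "is_basis E"
    and smooth_\<gamma>: "\<And>i. smooth (\<gamma> i)"
begin

abbreviation e :: "'n \<Rightarrow> 'g fibre" where "e i \<equiv> (0, E i, 0)"
abbreviation W :: "'n \<Rightarrow> 'g fibre" where "W i \<equiv> (0, 0, E i)"
abbreviation \<Gamma> :: "'g sect" where "\<Gamma> \<equiv> Gamma0 E \<gamma>"
abbreviation \<Lambda> :: "'n \<Rightarrow> 'n \<Rightarrow> real \<times> 'g \<Rightarrow> real" where "\<Lambda> \<equiv> lam br E \<gamma>"

text \<open>The part of \<open>phi\<close> without derivatives of \<open>\<Lambda>\<close> and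
  without products of two \<open>\<Lambda>\<close>. It turns out to be the coefficient matrix of the
  bracket of \<open>\<Gamma>\<close> with \<open>e i\<close>.\<close>

definition \<mu> :: "'n \<Rightarrow> 'n \<Rightarrow> real \<times> 'g \<Rightarrow> real" where
  "\<mu> i j p = - (\<Sum>k\<in>UNIV. \<Sum>l\<in>UNIV. coord E k (snd p) * struct_const br E k i l * pdw E l (\<gamma> j) p)
     - (\<Sum>k\<in>UNIV. \<gamma> k p * struct_const br E i k j)"

lemma phi_eq: "phi br E \<gamma> i j p
    = \<mu> i j p - gam_deriv E \<gamma> (\<Lambda> i j) p - (\<Sum>k\<in>UNIV. \<Lambda> i k p * \<Lambda> k j p)"
  by (simp add: phi_def \<mu>_def)

lemma Gamma0_eq: "\<Gamma> p = (1, snd p, \<Sum>j\<in>UNIV. \<gamma> j p *\<^sub>R E j)"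
  by (simp add: Gamma0_def T0_def ee_def We_def sum_prod basis_expansion[OF basis])

text \<open>The bracket of \<open>snd p\<close> with itself vanishes, so the anchor maps
  \<open>\<Gamma>\<close> to the reduced vector field.\<close>

lemma anchor_Gamma0: "anchor br p (\<Gamma> p) = (1, \<Sum>j\<in>UNIV. \<gamma> j p *\<^sub>R E j)"
  using lie_br by (simp add: Gamma0_eq anchor_Pair lie_algebra_def)

lemma lie_der_Gamma0:
  assumes "smooth f"
  shows "lie_der br f p (\<Gamma> p) = gam_deriv E \<gamma> f p"
proof -
  have lin: "linear (frechet_derivative f (at p))"
    by (intro linear_frechet_derivative smooth_imp_differentiable assms)
  have "anchor br p (\<Gamma> p) = (1, 0) + (\<Sum>j\<in>UNIV. \<gamma> j p *\<^sub>R (0, E j))"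
    by (simp add: anchor_Gamma0 sum_prod)
  then show ?thesis
    by (simp only: lie_der_def gam_deriv_def pdt_def pdw_def linear_add[OF lin] linear_sum[OF lin]
        linear_scale[OF lin] real_scaleR_def)
qed

lemma lie_der_W: "lie_der br f p (W i) = pdw E i f p"
  by (simp add: lie_der_def pdw_def anchor_Pair lie_algebra_bilin_simps[OF lie_br])

lemma smooth_coord: "smooth (\<lambda>p::real \<times> 'g. coord E i (snd p))"
proof -
  have "linear (\<lambda>p::real \<times> 'g. coord E i (snd p))"
    using linear_coord[OF basis, of i] by (auto simp: linear_iff)
  then show ?thesis by (rule smooth_linear)
qed

lemma smooth_pdw: "smooth f \<Longrightarrow> smooth (pdw E i f)"
  using smooth_directional[of f "(0, E i)"] by (simp add: pdw_def[abs_def])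

lemma smooth_lam: "smooth (\<Lambda> i j)"
  unfolding lam_def[abs_def]
  by (intro smooth_mult smooth_diff smooth_sum smooth_const smooth_coord smooth_pdw smooth_\<gamma>)

lemma has_derivative_Gamma0:
  "(\<Gamma> has_derivative (\<lambda>h. (0, snd h, \<Sum>j\<in>UNIV. frechet_derivative (\<gamma> j) (at p) h *\<^sub>R E j))) (at p)"
proof -
  have "((\<lambda>p. \<Sum>j\<in>UNIV. \<gamma> j p *\<^sub>R E j) has_derivative
      (\<lambda>h. \<Sum>j\<in>UNIV. frechet_derivative (\<gamma> j) (at p) h *\<^sub>R E j)) (at p)"
    by (intro has_derivative_sum has_derivative_scaleR_left smooth_has_derivative smooth_\<gamma>)
  then show ?thesis
    unfolding Gamma0_eq[abs_def]
    by (intro has_derivative_Pair has_derivative_const has_derivative_snd has_derivative_ident)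
qed

lemma smooth_Gamma0: "smooth \<Gamma>"
proof -
  have l: "linear (\<lambda>p::real \<times> 'g. (0::real, snd p, 0::'g))" by (rule linearI) auto
  have "\<Gamma> = (\<lambda>p. (1, 0, 0) + (0, snd p, 0) + (\<Sum>j\<in>UNIV. \<gamma> j p *\<^sub>R (0, 0, E j)))"
    by (rule ext) (simp add: Gamma0_eq sum_prod)
  moreover have "smooth (\<lambda>p. (1, 0, 0) + (0, snd p, 0)
      + (\<Sum>j\<in>UNIV. \<gamma> j p *\<^sub>R (0, 0, E j)) :: 'g fibre)"
    by (intro smooth_add smooth_sum smooth_scaleR smooth_linear[OF l] smooth_\<gamma> smooth_const)
  ultimately show ?thesis by simp
qed

lemma br_snd_basis:
  "br w (E i) = (\<Sum>j\<in>UNIV. (\<Sum>k\<in>UNIV. coord E k w * struct_const br E k i j) *\<^sub>R E j)"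
  using arg_cong[OF anchor_ee[OF lie_br basis, of "(0, w)" i], of snd]
  by (simp add: ee_def sum_prod lie_algebra_bilin_simps[OF lie_br])

text \<open>Differentiating the entry \<open>snd p\<close> of \<open>\<Gamma>\<close> along
  \<open>W i\<close> produces \<open>- e i\<close>. The vertical part is the expression whose half
  defines \<open>lam\<close>, hence the factor 2.\<close>

lemma relative_bracket_W:
  "relative_bracket br \<Gamma> p (W i) = - e i + (\<Sum>j\<in>UNIV. (2 * \<Lambda> i j p) *\<^sub>R W j)"
proof -
  have "relative_bracket br \<Gamma> p (W i)
      = (0, - E i, br (snd p) (E i) - (\<Sum>j\<in>UNIV. pdw E i (\<gamma> j) p *\<^sub>R E j))"
    unfolding relative_bracket_def frechet_derivative_at[OF has_derivative_Gamma0, symmetric]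
    by (simp add: Gamma0_eq anchor_Pair lie_algebra_bilin_simps[OF lie_br] pdw_def)
  also have "br (snd p) (E i) - (\<Sum>j\<in>UNIV. pdw E i (\<gamma> j) p *\<^sub>R E j)
      = (\<Sum>j\<in>UNIV. (2 * \<Lambda> i j p) *\<^sub>R E j)"
  proof -
    have "2 * \<Lambda> i j p = (\<Sum>k\<in>UNIV. coord E k (snd p) * struct_const br E k i j) - pdw E i (\<gamma> j) p" for j
      by (simp add: lam_def)
    then show ?thesis by (simp add: br_snd_basis scaleR_diff_left sum_subtractf)
  qed
  finally show ?thesis by (simp add: sum_prod)
qed

text \<open>The fibre bracket and the derivative of \<open>\<Gamma>\<close> both contribute
  \<open>br (snd p) (E i)\<close> to the middle component; these cancel, so the result is
  vertical.\<close>

lemma relative_bracket_e: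
  "relative_bracket br \<Gamma> p (e i) = (\<Sum>j\<in>UNIV. \<mu> i j p *\<^sub>R W j)"
proof -
  let ?g = "\<Sum>k\<in>UNIV. \<gamma> k p *\<^sub>R E k"
  have lin: "linear (frechet_derivative (\<gamma> j) (at p))" for j
    by (intro linear_frechet_derivative smooth_imp_differentiable smooth_\<gamma>)
  have "(0, br (snd p) (E i))
      = (\<Sum>l\<in>UNIV. (\<Sum>k\<in>UNIV. coord E k (snd p) * struct_const br E k i l) *\<^sub>R (0::real, E l))"
    by (simp add: br_snd_basis sum_prod)
  then have d: "frechet_derivative (\<gamma> j) (at p) (0, br (snd p) (E i))
      = (\<Sum>k\<in>UNIV. \<Sum>l\<in>UNIV. coord E k (snd p) * struct_const br E k i l * pdw E l (\<gamma> j) p)" for j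
    by (subst sum.swap) (simp only: linear_sum[OF lin] linear_scale[OF lin] pdw_def sum_distrib_right
        real_scaleR_def)
  have "br ?g (E i) = - (\<Sum>k\<in>UNIV. \<gamma> k p *\<^sub>R br (E i) (E k))"
    using lie_algebra_skew[OF lie_br, of ?g "E i"]
    by (simp add: linear_sum[OF lie_algebra_linear(1)[OF lie_br]] lie_algebra_bilin_simps[OF lie_br])
  also have "\<dots> = - (\<Sum>j\<in>UNIV. (\<Sum>k\<in>UNIV. \<gamma> k p * struct_const br E i k j) *\<^sub>R E j)"
    unfolding br_basis[OF basis] scaleR_sum_right scaleR_sum_left
    by (subst sum.swap) simp
  finally have g: "br ?g (E i) = - (\<Sum>j\<in>UNIV. (\<Sum>k\<in>UNIV. \<gamma> k p * struct_const br E i k j) *\<^sub>R E j)" .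
  have "relative_bracket br \<Gamma> p (e i)
      = (0, 0, br ?g (E i) - (\<Sum>j\<in>UNIV. frechet_derivative (\<gamma> j) (at p) (0, br (snd p) (E i)) *\<^sub>R E j))"
    unfolding relative_bracket_def frechet_derivative_at[OF has_derivative_Gamma0, symmetric]
    by (simp add: Gamma0_eq anchor_Pair lie_algebra_bilin_simps[OF lie_br])
  also have "br ?g (E i) - (\<Sum>j\<in>UNIV. frechet_derivative (\<gamma> j) (at p) (0, br (snd p) (E i)) *\<^sub>R E j)
      = (\<Sum>j\<in>UNIV. \<mu> i j p *\<^sub>R E j)"
    unfolding d g \<mu>_def by (simp add: scaleR_diff_left sum_subtractf sum_negf)
  finally show ?thesis by (simp add: sum_prod)
qed

text \<open>The frame contains \<open>\<Gamma> p\<close> instead of \<open>T0\<close>, because the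
  forms tested on it vanish on \<open>\<Gamma> p\<close>.\<close>

lemma frame_expansion: "\<exists>a c d. x = a *\<^sub>R \<Gamma> p + (\<Sum>i\<in>UNIV. c i *\<^sub>R e i) + (\<Sum>i\<in>UNIV. d i *\<^sub>R W i)"
proof -
  obtain a u v where x: "x = (a, u, v)" by (metis prod_cases3)
  have "x = a *\<^sub>R \<Gamma> p + (\<Sum>i\<in>UNIV. coord E i (u - a *\<^sub>R snd p) *\<^sub>R e i)
      + (\<Sum>i\<in>UNIV. coord E i (v - a *\<^sub>R (\<Sum>j\<in>UNIV. \<gamma> j p *\<^sub>R E j)) *\<^sub>R W i)"
    by (simp add: x Gamma0_eq sum_prod basis_expansion[OF basis])
  then show ?thesis by (intro exI)
qed

lemma linear_zero_on_frame:
  fixes f :: "'g fibre \<Rightarrow> real"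
  assumes f: "linear f" and "f (\<Gamma> p) = 0" "\<And>i. f (e i) = 0" "\<And>i. f (W i) = 0"
  shows "f x = 0"
proof -
  obtain a c d where "x = a *\<^sub>R \<Gamma> p + (\<Sum>i\<in>UNIV. c i *\<^sub>R e i) + (\<Sum>i\<in>UNIV. d i *\<^sub>R W i)"
    using frame_expansion by blast
  then show ?thesis
    by (simp add: linear_add[OF f] linear_sum[OF f] linear_scale[OF f] assms(2-4) del: scaleR_Pair)
qed

end

text \<open>Two-forms satisfying the algebraic conditions of the theorem apart from maximal rank.
  They are determined by the matrix \<open>K\<close> and the values on pairs \<open>e i\<close>,
  \<open>e j\<close>.\<close>

locale semibasic_two_form = ip_algebroid br E \<gamma> + smooth_two_form br B
  for br :: "'g::euclidean_space \<Rightarrow> 'g \<Rightarrow> 'g" and E :: "'n::finite \<Rightarrow> 'g" and \<gamma> B +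
  assumes B_W_W: "\<And>p i j. B p (0, 0, E i) (0, 0, E j) = 0"
    and B_Gamma0: "\<And>p y. B p (Gamma0 E \<gamma> p) y = 0"
begin

abbreviation K :: "'n \<Rightarrow> 'n \<Rightarrow> real \<times> 'g \<Rightarrow> real" where "K i j p \<equiv> B p (W i) (e j)"
abbreviation \<Delta> :: "real \<times> 'g \<Rightarrow> 'g fibre \<Rightarrow> 'g fibre \<Rightarrow> 'g fibre \<Rightarrow> real" where "\<Delta> \<equiv> delta2 br B"

lemma B_e_W: "B p (e i) (W j) = - K j i p"
  by (rule skew)

lemma B_vertical: "B p (0, 0, u) (0, 0, v) = 0"
proof -
  have *: "(\<Sum>i\<in>UNIV. coord E i x *\<^sub>R W i) = (0, 0, x)" for x
    by (simp add: sum_prod basis_expansion[OF basis])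
  have "B p (\<Sum>i\<in>UNIV. coord E i u *\<^sub>R W i) (\<Sum>i\<in>UNIV. coord E i v *\<^sub>R W i) = 0"
    by (simp add: B_simps B_W_W del: scaleR_Pair)
  then show ?thesis unfolding * .
qed

section \<open>Components of the exterior derivative in the frame\<close>

lemma delta2_Gamma0_W_W: "\<Delta> p (\<Gamma> p) (W i) (W j) = K i j p - K j i p"
  by (simp add: delta2_contract[OF smooth_Gamma0 B_Gamma0] relative_bracket_W B_simps B_W_W B_e_W
      del: scaleR_Pair uminus_Pair)

lemma delta2_Gamma0_W_e: "\<Delta> p (\<Gamma> p) (W i) (e j)
    = gam_deriv E \<gamma> (K i j) p + B p (e i) (e j) - 2 * (\<Sum>l\<in>UNIV. \<Lambda> i l p * K l j p)"
  by (simp add: delta2_contract[OF smooth_Gamma0 B_Gamma0] relative_bracket_W relative_bracket_e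
      B_simps B_W_W lie_der_Gamma0 smoothB sum_distrib_left mult.assoc del: scaleR_Pair uminus_Pair)

lemma delta2_Gamma0_e_e: "\<Delta> p (\<Gamma> p) (e i) (e j) = gam_deriv E \<gamma> (\<lambda>q. B q (e i) (e j)) p
    - (\<Sum>l\<in>UNIV. \<mu> i l p * K l j p) + (\<Sum>l\<in>UNIV. \<mu> j l p * K l i p)"
  by (simp add: delta2_contract[OF smooth_Gamma0 B_Gamma0] relative_bracket_e
      B_simps B_e_W lie_der_Gamma0 smoothB sum_negf del: scaleR_Pair uminus_Pair)

lemma delta2_W_W_e: "\<Delta> p (W i) (W j) (e k) = pdw E i (K j k) p - pdw E j (K i k) p"
  by (simp add: delta2_def lie_der_W B_W_W B_vertical B_simps lie_algebra_bilin_simps[OF lie_br]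
      flip: zero_prod_def)

lemma delta2_W_W_W: "\<Delta> p (W i) (W j) (W k) = 0"
  by (simp add: delta2_def B_vertical lie_algebra_bilin_simps[OF lie_br])

text \<open>Differentiating \<open>horiz\<close> along \<open>\<Gamma>\<close> yields the derivative
  of \<open>\<Lambda>\<close> and the product of two \<open>\<Lambda>\<close> that complete
  \<open>\<mu>\<close> to \<open>phi\<close>. The other quadratic term is symmetric and drops
  out.\<close>

lemma delta2_Gamma0_e_e_phi:
  assumes sym: "\<And>p i j. K i j p = K j i p"
    and mult: "\<And>p i j. gam_deriv E \<gamma> (K i j) p
      = (\<Sum>l\<in>UNIV. \<Lambda> i l p * K l j p) + (\<Sum>l\<in>UNIV. \<Lambda> j l p * K l i p)"
    and horiz: "\<And>p i j. B p (e i) (e j)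
      = (\<Sum>l\<in>UNIV. \<Lambda> i l p * K l j p) - (\<Sum>l\<in>UNIV. \<Lambda> j l p * K l i p)"
  shows "\<Delta> p (\<Gamma> p) (e i) (e j) = (\<Sum>l\<in>UNIV. K l i p * phi br E \<gamma> j l p) - (\<Sum>l\<in>UNIV. K l j p * phi br E \<gamma> i l p)"
proof -
  define g where "g = gam_deriv E \<gamma>"
  have g_lie: "g f p = lie_der br f p (\<Gamma> p)" if "smooth f" for f
    using lie_der_Gamma0[OF that] by (simp add: g_def)
  \<comment> \<open>The derivative of \<open>P\<close> splits three ways: \<open>R\<close>
    differentiates \<open>\<Lambda>\<close>, while \<open>mult\<close> turns the derivative of
    \<open>K\<close> into \<open>S\<close>, the quadratic term of \<open>phi\<close>, and
    \<open>Q\<close>, with one \<open>\<Lambda>\<close> on each index of \<open>K\<close>.\<close>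
  define P where "P i j p = (\<Sum>l\<in>UNIV. \<Lambda> i l p * K l j p)" for i j p
  define R where "R i j = (\<Sum>l\<in>UNIV. g (\<Lambda> i l) p * K l j p)" for i j
  define S where "S i j = (\<Sum>l\<in>UNIV. (\<Sum>k\<in>UNIV. \<Lambda> i k p * \<Lambda> k l p) * K l j p)" for i j
  define Q where "Q i j = (\<Sum>l\<in>UNIV. \<Lambda> i l p * P j l p)" for i j
  have sP: "smooth (P i j)" for i j
    unfolding P_def[abs_def] by (intro smooth_sum smooth_mult smooth_lam smoothB)
  have gP: "g (P i j) p = R i j + S i j + Q i j" for i j
  proof -
    have "g (P i j) p = lie_der br (\<lambda>q. \<Sum>l\<in>UNIV. \<Lambda> i l q * K l j q) p (\<Gamma> p)"
      using g_lie[OF sP] by (simp add: P_def[abs_def])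
    also have "\<dots> = (\<Sum>l\<in>UNIV. \<Lambda> i l p * lie_der br (K l j) p (\<Gamma> p) + lie_der br (\<Lambda> i l) p (\<Gamma> p) * K l j p)"
      by (simp add: lie_der_sum lie_der_mult smooth_lam smoothB smooth_mult)
    also have "\<dots> = (\<Sum>l\<in>UNIV. \<Lambda> i l p * (P l j p + P j l p)) + R i j"
      unfolding g_lie[OF smoothB, symmetric] g_lie[OF smooth_lam, symmetric] R_def sum.distrib
      unfolding g_def mult P_def by simp
    also have "(\<Sum>l\<in>UNIV. \<Lambda> i l p * P l j p) = S i j"
      unfolding P_def S_def sum_distrib_left sum_distrib_right
      by (subst sum.swap) (simp add: mult.assoc)
    then have "(\<Sum>l\<in>UNIV. \<Lambda> i l p * (P l j p + P j l p)) = S i j + Q i j"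
      by (simp add: Q_def distrib_left sum.distrib)
    finally show ?thesis by simp
  qed
  \<comment> \<open>Symmetry of \<open>K\<close> makes \<open>Q\<close> symmetric, so it cancels in
    \<open>P i j - P j i\<close>.\<close>
  have Q: "Q i j = Q j i" for i j
  proof -
    have "Q i j = (\<Sum>l\<in>UNIV. \<Sum>m\<in>UNIV. \<Lambda> j m p * (\<Lambda> i l p * K m l p))"
      unfolding Q_def P_def by (simp add: sum_distrib_left mult.left_commute)
    also have "\<dots> = (\<Sum>m\<in>UNIV. \<Sum>l\<in>UNIV. \<Lambda> j m p * (\<Lambda> i l p * K l m p))"
      by (subst sum.swap) (simp add: sym)
    also have "\<dots> = Q j i"
      unfolding Q_def P_def by (simp add: sum_distrib_left)
    finally show ?thesis .
  qed
  have "g (\<lambda>q. B q (e i) (e j)) p = g (P i j) p - g (P j i) p"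
  proof -
    have "(\<lambda>q. B q (e i) (e j)) = (\<lambda>q. P i j q - P j i q)"
      by (simp add: horiz P_def)
    then show ?thesis
      using g_lie[OF smooth_diff[OF sP sP], of i j j i] lie_der_diff[OF sP sP] by (simp add: g_lie sP)
  qed
  then have 1: "g (\<lambda>q. B q (e i) (e j)) p = R i j + S i j - R j i - S j i"
    using gP[of i j] gP[of j i] Q[of i j] by simp
  have 2: "(\<Sum>l\<in>UNIV. K l j p * phi br E \<gamma> i l p) = (\<Sum>l\<in>UNIV. \<mu> i l p * K l j p) - R i j - S i j" for i j
    unfolding phi_eq R_def S_def g_def
    by (simp add: algebra_simps sum_subtractf sum.distrib sum_distrib_left)
  show ?thesis
    unfolding delta2_Gamma0_e_e 2 using 1 by (simp add: g_def)
qed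

lemma delta2_alternating:
  "\<Delta> p x x y = 0" "\<Delta> p x y y = 0" "\<Delta> p x y x = 0"
  using delta2_swap12[of p x x y] delta2_swap23[of p x y y] delta2_swap12[of p x y x] delta2_swap23[of p y x x]
  by auto

lemma delta2_Gamma0_eq_0:
  assumes "\<And>p i j. \<Delta> p (\<Gamma> p) (W i) (W j) = 0" "\<And>p i j. \<Delta> p (\<Gamma> p) (W i) (e j) = 0"
    "\<And>p i j. \<Delta> p (\<Gamma> p) (e i) (e j) = 0"
  shows "\<Delta> p (\<Gamma> p) y z = 0"
proof (rule linear_zero_on_frame[where p = p, OF linear_delta2_2], goal_cases)
  case 1
  show ?case by (rule delta2_alternating)
next
  case (2 i)
  show ?case
    by (rule linear_zero_on_frame[where p = p, OF linear_delta2_3])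
      (use assms delta2_alternating delta2_swap23[of p "\<Gamma> p" "W _" "e i"] in auto)
next
  case (3 i)
  show ?case
    by (rule linear_zero_on_frame[where p = p, OF linear_delta2_3]) (use assms delta2_alternating in auto)
qed

text \<open>Invariance of \<open>\<Delta>\<close> under \<open>\<Gamma>\<close> propagates the vanishing from the arguments \<open>W, W, e\<close> to
  \<open>W, e, e\<close> and then to \<open>e, e, e\<close>, because the bracket of \<open>\<Gamma>\<close> with \<open>W i\<close> is \<open>- e i\<close> up to
  vertical terms. In the first step \<open>\<Delta> (W i) (e j) (e k)\<close> turns out to be symmetric in \<open>i, j\<close>
  and alternating in \<open>j, k\<close>.\<close>

lemma delta2_eq_0:
  assumes ker: "\<And>p y z. \<Delta> p (\<Gamma> p) y z = 0"
    and WWe: "\<And>p i j k. \<Delta> p (W i) (W j) (e k) = 0"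
  shows "\<Delta> p x y z = 0"
proof -
  note inv = delta2_invariant[OF smooth_Gamma0 ker]
  note lin = linear_delta2_1[THEN linear_add] linear_delta2_1[THEN linear_diff]
    linear_delta2_1[THEN linear_sum] linear_delta2_1[THEN linear_scale]
    linear_delta2_2[THEN linear_add] linear_delta2_2[THEN linear_diff]
    linear_delta2_2[THEN linear_sum] linear_delta2_2[THEN linear_scale]
    linear_delta2_3[THEN linear_add] linear_delta2_3[THEN linear_diff]
    linear_delta2_3[THEN linear_sum] linear_delta2_3[THEN linear_scale]
  have ker': "\<Delta> p y (\<Gamma> p) z = 0" "\<Delta> p y z (\<Gamma> p) = 0" for p y z
    using delta2_swap12[of p y "\<Gamma> p" z] delta2_swap23[of p y z "\<Gamma> p"] delta2_swap12[of p y "\<Gamma> p"] ker by auto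
  have WW: "\<Delta> p (W i) (W j) x = 0" for p i j x
    by (rule linear_zero_on_frame[where p = p, OF linear_delta2_3]) (auto simp: ker' WWe delta2_W_W_W)
  have WW': "\<Delta> p (W i) x (W j) = 0" "\<Delta> p x (W i) (W j) = 0" for p i j x
    using delta2_swap23[of p "W i" x "W j"] delta2_swap12[of p x "W i" "W j"] delta2_swap23[of p "W i" x "W j"]
      WW[of p i j x] by auto
  \<comment> \<open>The left side of \<open>inv\<close> differentiates the zero function, and
    vertical terms of the brackets give components already known to vanish; only the two
    \<open>- e\<close> terms survive.\<close>
  have WeE: "\<Delta> p (e i) (W j) (e k) + \<Delta> p (W i) (e j) (e k) = 0" for p i j k
    using inv[of "W i" "W j" "e k" p]
    by (simp add: relative_bracket_W relative_bracket_e WW WW' lin del: scaleR_Pair uminus_Pair)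
  have sym: "\<Delta> p (W i) (e j) (e k) = \<Delta> p (W j) (e i) (e k)" for p i j k
    using WeE[of p i j k] delta2_swap12[of p "W j" "e i" "e k"] by linarith
  have alt: "\<Delta> p (W i) (e j) (e k) = - \<Delta> p (W i) (e k) (e j)" for p i j k
    by (rule delta2_swap23)
  \<comment> \<open>Alternating the symmetry in the first two indices with the skew-symmetry in the
    last two returns to the start after six exchanges, three of them with a sign.\<close>
  have Wee: "\<Delta> p (W i) (e j) (e k) = 0" for p i j k
    using sym[of p i j k] alt[of p j i k] sym[of p j k i] alt[of p k j i] sym[of p k i j] alt[of p i k j]
    by linarith
  have eee: "\<Delta> p (e i) (e j) (e k) = 0" for p i j k
    using inv[of "W i" "e j" "e k" p]
    by (simp add: relative_bracket_W relative_bracket_e Wee WW WW' lin del: scaleR_Pair uminus_Pair)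
  have Wxx: "\<Delta> p (W i) y z = 0" for p i y z
  proof (rule linear_zero_on_frame[where p = p, OF linear_delta2_2])
    show "\<Delta> p (W i) (e j) z = 0" for j
      by (rule linear_zero_on_frame[where p = p, OF linear_delta2_3]) (auto simp: ker' Wee WW')
  qed (auto simp: ker' WW)
  have exx: "\<Delta> p (e i) y z = 0" for i
  proof (rule linear_zero_on_frame[where p = p, OF linear_delta2_2])
    show "\<Delta> p (e i) (W j) z = 0" for j
      using delta2_swap12[of p "e i" "W j" z] Wxx by simp
    show "\<Delta> p (e i) (e j) z = 0" for j
    proof (rule linear_zero_on_frame[where p = p, OF linear_delta2_3])
      show "\<Delta> p (e i) (e j) (W k) = 0" for k
        using delta2_swap23[of p "e i" "e j" "W k"] delta2_swap12[of p "e i" "W k" "e j"] Wxx by simp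
    qed (auto simp: ker' eee)
  qed (auto simp: ker')
  show ?thesis
    by (rule linear_zero_on_frame[where p = p, OF linear_delta2_1]) (auto simp: ker Wxx exx)
qed

end

section \<open>Powers of two-forms\<close>

text \<open>The updated entry \<open>i\<close> is read at exactly one position,
  \<open>inv \<pi> i\<close>. Hence an update affects just one of the two factors in a summand of a
  wedge product.\<close>

lemma map_nth_update_permutes:
  assumes \<pi>: "\<pi> permutes {..<length vs}" and i: "i < length vs"
  shows "map (\<lambda>j. vs[i := v] ! \<pi> j) [m..<n] =
    (if m \<le> inv \<pi> i \<and> inv \<pi> i < n then (map (\<lambda>j. vs ! \<pi> j) [m..<n])[inv \<pi> i - m := v]
     else map (\<lambda>j. vs ! \<pi> j) [m..<n])"
proof -
  define j0 where "j0 = inv \<pi> i"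
  have iff: "i = \<pi> j \<longleftrightarrow> j = j0" for j
    using permutes_inverses[OF \<pi>] unfolding j0_def by metis
  have "vs[i := v] ! \<pi> j = (if j = j0 then v else vs ! \<pi> j)" for j
    using i by (cases "j = j0") (simp_all add: nth_list_update flip: iff)
  then show ?thesis
    unfolding j0_def[symmetric] by (auto simp: list_eq_iff_nth_eq nth_list_update)
qed

text \<open>Each summand is linear in an entry because only one factor contains it. If two entries
  agree, composing with their transposition reverses the sign of each summand, so the sum is its own
  negative.\<close>

lemma alternating_multilinear_wedge:
  assumes a: "alternating_multilinear p (\<alpha> x)" and b: "alternating_multilinear q (\<beta> x)"
  shows "alternating_multilinear (p + q) (wedge p q \<alpha> \<beta> x)"
  unfolding alternating_multilinear_def
proof (intro conjI allI impI; elim conjE)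
  fix vs :: "'a fibre list" and i
  assume len: "length vs = p + q" and i: "i < p + q"
  have lin: "linear (\<lambda>v. \<alpha> x (map (\<lambda>j. vs[i := v] ! \<pi> j) [0..<p]) * \<beta> x (map (\<lambda>j. vs[i := v] ! \<pi> j) [p..<p + q]))"
    if \<pi>: "\<pi> permutes {..<p + q}" for \<pi>
  proof -
    have "inv \<pi> i < p + q"
      using permutes_in_image[OF permutes_inv[OF \<pi>]] i by simp
    note upd = map_nth_update_permutes[of \<pi> vs i, unfolded len, OF \<pi> i]
    show ?thesis
    proof (cases "inv \<pi> i < p")
      case True
      then have "linear (\<lambda>v. \<alpha> x ((map (\<lambda>j. vs ! \<pi> j) [0..<p])[inv \<pi> i := v]))"
        using a by (simp add: alternating_multilinear_def)
      then show ?thesis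
        using True by (simp add: upd linear_iff algebra_simps)
    next
      case False
      then have "linear (\<lambda>v. \<beta> x ((map (\<lambda>j. vs ! \<pi> j) [p..<p + q])[inv \<pi> i - p := v]))"
        using b \<open>inv \<pi> i < p + q\<close> by (simp add: alternating_multilinear_def)
      then show ?thesis
        using False \<open>inv \<pi> i < p + q\<close> by (simp add: upd linear_iff algebra_simps)
    qed
  qed
  have "linear (\<lambda>v. \<Sum>\<pi> | \<pi> permutes {..<p + q}. (real_of_int (sign \<pi>) / (fact p * fact q)) *\<^sub>R
      (\<alpha> x (map (\<lambda>j. vs[i := v] ! \<pi> j) [0..<p]) * \<beta> x (map (\<lambda>j. vs[i := v] ! \<pi> j) [p..<p + q])))"
    by (intro linear_compose_sum ballI linear_compose_scale_right lin) auto
  then show "linear (\<lambda>v. wedge p q \<alpha> \<beta> x (vs[i := v]))"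
    by (simp add: wedge_def sum_divide_distrib mult.assoc)
next
  fix vs :: "'a fibre list"
  assume len: "length vs = p + q" and "\<not> distinct vs"
  then obtain i j where ij: "i < p + q" "j < p + q" "i \<noteq> j" "vs ! i = vs ! j"
    by (auto simp: distinct_conv_nth)
  define f where "f \<pi> = real_of_int (sign \<pi>) * \<alpha> x (map (\<lambda>k. vs ! \<pi> k) [0..<p])
      * \<beta> x (map (\<lambda>k. vs ! \<pi> k) [p..<p + q])" for \<pi>
  have tr: "Transposition.transpose i j permutes {..<p + q}"
    using ij by (intro permutes_swap_id) auto
  have "f (Transposition.transpose i j \<circ> \<pi>) = - f \<pi>" if "\<pi> permutes {..<p + q}" for \<pi>
  proof -
    have "sign (Transposition.transpose i j \<circ> \<pi>) = - sign \<pi>"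
      using that tr ij(3) by (subst sign_compose)
        (auto simp: sign_swap_id permutes_imp_permutation[of "{..<p + q}"])
    moreover have "vs ! Transposition.transpose i j k = vs ! k" for k
      using ij(4) by (auto simp: Transposition.transpose_def)
    ultimately show ?thesis by (simp add: f_def)
  qed
  then have "sum f {\<pi>. \<pi> permutes {..<p + q}} = - sum f {\<pi>. \<pi> permutes {..<p + q}}"
    by (subst setum_permutations_compose_left[OF tr]) (simp add: sum_negf)
  then have "sum f {\<pi>. \<pi> permutes {..<p + q}} = 0" by simp
  then show "wedge p q \<alpha> \<beta> x vs = 0"
    by (simp add: wedge_def f_def)
qed

lemma alternating_multilinear_wedge_power:
  assumes "alternating_multilinear 2 (\<Omega> x)"
  shows "alternating_multilinear (2 * k) (wedge_power \<Omega> k x)"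
proof (induction k)
  case 0
  then show ?case by (simp add: alternating_multilinear_def)
next
  case (Suc k)
  from alternating_multilinear_wedge[where \<alpha> = \<Omega> and \<beta> = "wedge_power \<Omega> k" and x = x, OF assms Suc] show ?case by simp
qed

lemma map_upt_2: "map f [0..<2] = [f 0, f 1]"
  by (simp add: numeral_2_eq_2)

text \<open>In every summand the kernel vector \<open>u\<close> occurs either in the factor
  \<open>\<Omega>\<close> or among the arguments of the lower power, where induction
  applies.\<close>

lemma wedge_power_kernel:
  assumes ker: "\<And>y. \<Omega> x [u, y] = 0" "\<And>y. \<Omega> x [y, u] = 0"
  shows "length vs = 2 * k \<Longrightarrow> u \<in> set vs \<Longrightarrow> wedge_power \<Omega> k x vs = 0"
proof (induction k arbitrary: vs)
  case 0
  then show ?case by simp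
next
  case (Suc k)
  note upt_Suc [simp del]
  from Suc obtain i where i: "i < 2 + 2 * k" "vs ! i = u" by (auto simp: in_set_conv_nth)
  have "\<Omega> x (map (\<lambda>j. vs ! \<pi> j) [0..<2]) * wedge_power \<Omega> k x (map (\<lambda>j. vs ! \<pi> j) [2..<2 + 2 * k]) = 0"
    if \<pi>: "\<pi> permutes {..<2 + 2 * k}" for \<pi>
  proof -
    define j where "j = inv \<pi> i"
    have \<pi>j: "\<pi> j = i" using permutes_inverses[OF \<pi>] by (simp add: j_def)
    have j: "j < 2 + 2 * k"
      using permutes_in_image[OF permutes_inv[OF \<pi>]] i by (simp add: j_def)
    show ?thesis
    proof (cases "j < 2")
      case True
      then consider "j = 0" | "j = 1" by linarith
      then have "\<Omega> x (map (\<lambda>j. vs ! \<pi> j) [0..<2]) = 0"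
        using i(2) \<pi>j by cases (simp_all add: map_upt_2 ker)
      then show ?thesis by simp
    next
      case False
      then have "u \<in> set (map (\<lambda>j. vs ! \<pi> j) [2..<2 + 2 * k])"
        using j i(2) \<pi>j by (auto simp: image_iff intro!: bexI[of _ j])
      then show ?thesis using Suc.IH by simp
    qed
  qed
  then show ?case by (auto simp: wedge_def mult.assoc intro!: sum.neutral)
qed

text \<open>Substitute the combination at the position of \<open>w\<close> and expand: all terms but
  one repeat an entry, and the remaining one is \<open>c w * a vs\<close>.\<close>

lemma alternating_multilinear_eq_0:
  assumes a: "alternating_multilinear m a" and vs: "length vs = m" "distinct vs"
    and c: "w \<in> set vs" "c w \<noteq> 0"
    and z: "\<And>i. i < m \<Longrightarrow> a (vs[i := \<Sum>v\<in>set vs. c v *\<^sub>R v]) = 0"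
  shows "a vs = 0"
proof -
  obtain i where i: "i < m" "vs ! i = w" using c(1) vs(1) by (auto simp: in_set_conv_nth)
  have lin: "linear (\<lambda>v. a (vs[i := v]))" using a vs(1) i(1) by (simp add: alternating_multilinear_def)
  have other: "a (vs[i := v]) = 0" if v: "v \<in> set vs" "v \<noteq> w" for v
  proof -
    obtain j where j: "j < m" "vs ! j = v" using v(1) vs(1) by (auto simp: in_set_conv_nth)
    with v i have "i \<noteq> j" by auto
    then have "\<not> distinct (vs[i := v])"
      using nth_eq_iff_index_eq[of "vs[i := v]" i j] j i vs(1) by (auto simp: nth_list_update)
    then show ?thesis using a vs(1) by (simp add: alternating_multilinear_def)
  qed
  have "0 = (\<Sum>v\<in>set vs. c v * a (vs[i := v]))"
    using z[OF i(1)] by (simp add: linear_sum[OF lin] linear_scale[OF lin])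
  also have "\<dots> = (\<Sum>v\<in>{w}. c v * a (vs[i := v]))"
    using c(1) other by (intro sum.mono_neutral_right) auto
  also have "\<dots> = c w * a vs" using i by auto
  finally show ?thesis using c(2) by simp
qed

text \<open>By dimension, \<open>2 * k\<close> vectors always have a nontrivial combination inside
  the kernel \<open>N\<close>; \<open>alternating_multilinear_eq_0\<close> then applies.\<close>

lemma wedge_power_eq_0:
  fixes \<Omega> :: "('g::euclidean_space) form"
  assumes alt: "alternating_multilinear 2 (\<Omega> x)"
    and N: "subspace N" "dim N + 2 * k > DIM('g fibre)"
    and ker: "\<And>u y. u \<in> N \<Longrightarrow> \<Omega> x [u, y] = 0" "\<And>u y. u \<in> N \<Longrightarrow> \<Omega> x [y, u] = 0"
  shows "form_zero_at (2 * k) (wedge_power \<Omega> k) x"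
  unfolding form_zero_at_def
proof (intro allI impI)
  fix vs :: "'g fibre list" assume len: "length vs = 2 * k"
  let ?a = "wedge_power \<Omega> k x"
  have a: "alternating_multilinear (2 * k) ?a" by (rule alternating_multilinear_wedge_power[where \<Omega> = \<Omega> and x = x, OF alt])
  show "?a vs = 0"
  proof (cases "distinct vs")
    case False
    then show ?thesis using a len by (simp add: alternating_multilinear_def)
  next
    case True
    \<comment> \<open>For dependent vectors the combination is zero; for independent ones their span
      meets \<open>N\<close> nontrivially.\<close>
    have "\<exists>c. (\<exists>w\<in>set vs. c w \<noteq> 0) \<and> (\<Sum>v\<in>set vs. c v *\<^sub>R v) \<in> N"
    proof (cases "dependent (set vs)")
      case True
      then show ?thesis
        using subspace_0[OF N(1)] by (auto simp: real_vector.dependent_finite)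
    next
      case False
      have "dim (span (set vs)) = 2 * k"
        using False True len by (simp add: dim_eq_card_independent distinct_card)
      moreover have "dim {y + z |y z. y \<in> span (set vs) \<and> z \<in> N} + dim (span (set vs) \<inter> N)
          = dim (span (set vs)) + dim N"
        by (intro dim_sums_Int subspace_span N)
      moreover have "dim {y + z |y z. y \<in> span (set vs) \<and> z \<in> N} \<le> DIM('g fibre)"
        by (rule dim_subset_UNIV)
      ultimately have "dim (span (set vs) \<inter> N) \<noteq> 0" using N(2) by linarith
      then obtain u where u: "u \<in> span (set vs)" "u \<in> N" "u \<noteq> 0"
        by (auto simp: dim_eq_0)
      then obtain c where c: "u = (\<Sum>v\<in>set vs. c v *\<^sub>R v)"
        by (auto simp: real_vector.span_finite)
      have "\<exists>w\<in>set vs. c w \<noteq> 0"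
      proof (rule ccontr)
        assume "\<not> (\<exists>w\<in>set vs. c w \<noteq> 0)"
        then have "u = 0" unfolding c by (intro sum.neutral) auto
        then show False using u(3) by contradiction
      qed
      then show ?thesis using u(2) c by auto
    qed
    then obtain c w where "w \<in> set vs" "c w \<noteq> 0" and u: "(\<Sum>v\<in>set vs. c v *\<^sub>R v) \<in> N" by blast
    moreover have "?a (vs[i := \<Sum>v\<in>set vs. c v *\<^sub>R v]) = 0" if "i < 2 * k" for i
      by (rule wedge_power_kernel[where \<Omega> = \<Omega>, OF ker(1)[OF u] ker(2)[OF u]])
        (use len that in \<open>auto intro!: set_update_memI\<close>)
    ultimately show ?thesis by (intro alternating_multilinear_eq_0[OF a len True])
  qed
qed

text \<open>The permutation sum in \<open>wedge_power\<close> is unrolled one factor at a time: composing with the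
  permutations of the last \<open>2 * k\<close> positions does not change a sum over all permutations.\<close>

lemma wedge_power_eq_sum:
  "wedge_power \<Omega> k x vs = (\<Sum>\<pi> | \<pi> permutes {..<2 * k}.
     real_of_int (sign \<pi>) * (\<Prod>i<k. \<Omega> x [vs ! \<pi> (2 * i), vs ! \<pi> (2 * i + 1)])) / 2 ^ k"
proof (induction k arbitrary: vs)
  case 0
  then show ?case by simp
next
  case (Suc k)
  note upt_Suc [simp del]
  define T where "T \<pi> = real_of_int (sign \<pi>) * (\<Prod>i<Suc k. \<Omega> x [vs ! \<pi> (2 * i), vs ! \<pi> (2 * i + 1)])" for \<pi>
  \<comment> \<open>\<open>sh \<sigma>\<close> performs \<open>\<sigma>\<close> on the positions
    from 2 onwards and fixes 0 and 1, the positions of the first factor.\<close>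
  define sh where "sh \<sigma> = map_permutation {..<2 * k} (\<lambda>j. j + 2) \<sigma>" for \<sigma> :: "nat \<Rightarrow> nat"
  have inj: "inj_on (\<lambda>j::nat. j + 2) A" for A by (simp add: inj_on_def)
  have sh_perm: "sh \<sigma> permutes {2..<2 + 2 * k}" if "\<sigma> permutes {..<2 * k}" for \<sigma>
  proof -
    have "x \<in> (\<lambda>j. j + 2) ` {..<2 * k} \<longleftrightarrow> x \<in> {2..<2 + 2 * k}" for x
      by (simp add: image_iff Bex_def) presburger
    then have "(\<lambda>j. j + 2) ` {..<2 * k} = {2..<2 + 2 * k}" by blast
    with map_permutation_permutes[OF inj_on_imp_bij_betw[OF inj] that] show ?thesis by (simp add: sh_def)
  qed
  have sh_perm': "sh \<sigma> permutes {..<2 + 2 * k}" if "\<sigma> permutes {..<2 * k}" for \<sigma>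
    by (rule permutes_subset[OF sh_perm[OF that]]) auto
  have T_sh: "T (\<pi> \<circ> sh \<sigma>) = real_of_int (sign \<pi>) * \<Omega> x (map (\<lambda>i. vs ! \<pi> i) [0..<2])
      * (real_of_int (sign \<sigma>) * (\<Prod>i<k. \<Omega> x [map (\<lambda>i. vs ! \<pi> i) [2..<2 + 2 * k] ! \<sigma> (2 * i),
          map (\<lambda>i. vs ! \<pi> i) [2..<2 + 2 * k] ! \<sigma> (2 * i + 1)]))"
    if \<pi>: "\<pi> permutes {..<2 + 2 * k}" and \<sigma>: "\<sigma> permutes {..<2 * k}" for \<pi> \<sigma>
  proof -
    have sgn: "sign (\<pi> \<circ> sh \<sigma>) = sign \<pi> * sign \<sigma>"
    proof -
      have "sign (sh \<sigma>) = sign \<sigma>"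
        unfolding sh_def using \<sigma> by (intro sign_map_permutation inj) auto
      then show ?thesis
        using sign_compose[of \<pi> "sh \<sigma>"] \<pi> sh_perm'[OF \<sigma>]
        by (simp add: permutes_imp_permutation[of "{..<2 + 2 * k}"])
    qed
    have s01: "sh \<sigma> 0 = 0" "sh \<sigma> 1 = 1"
      using permutes_not_in[OF sh_perm[OF \<sigma>]] by auto
    have s: "sh \<sigma> (j + 2) = \<sigma> j + 2" if "j < 2 * k" for j
      unfolding sh_def using that by (intro map_permutation_apply inj) auto
    have lt: "\<sigma> j < 2 * k" if "j < 2 * k" for j
      using permutes_in_image[OF \<sigma>] that by auto
    have "(\<Prod>i<k. \<Omega> x [vs ! \<pi> (sh \<sigma> (2 * Suc i)), vs ! \<pi> (sh \<sigma> (2 * Suc i + 1))])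
       = (\<Prod>i<k. \<Omega> x [map (\<lambda>i. vs ! \<pi> i) [2..<2 + 2 * k] ! \<sigma> (2 * i),
          map (\<lambda>i. vs ! \<pi> i) [2..<2 + 2 * k] ! \<sigma> (2 * i + 1)])"
    proof (rule prod.cong[OF refl])
      fix i assume "i \<in> {..<k}"
      then have l: "2 * i < 2 * k" "2 * i + 1 < 2 * k" by auto
      show "\<Omega> x [vs ! \<pi> (sh \<sigma> (2 * Suc i)), vs ! \<pi> (sh \<sigma> (2 * Suc i + 1))]
        = \<Omega> x [map (\<lambda>i. vs ! \<pi> i) [2..<2 + 2 * k] ! \<sigma> (2 * i),
          map (\<lambda>i. vs ! \<pi> i) [2..<2 + 2 * k] ! \<sigma> (2 * i + 1)]"
        using s[OF l(1)] s[OF l(2)] lt[OF l(1)] lt[OF l(2)] by (simp add: add.commute)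
    qed
    then show ?thesis
      by (simp add: T_def sgn prod.lessThan_Suc_shift s01 s01(2)[unfolded One_nat_def] map_upt_2 del: prod.lessThan_Suc)
  qed
  have inner: "real_of_int (sign \<pi>) * \<Omega> x (map (\<lambda>i. vs ! \<pi> i) [0..<2])
      * wedge_power \<Omega> k x (map (\<lambda>i. vs ! \<pi> i) [2..<2 + 2 * k])
      = (\<Sum>\<sigma> | \<sigma> permutes {..<2 * k}. T (\<pi> \<circ> sh \<sigma>)) / 2 ^ k" if "\<pi> permutes {..<2 + 2 * k}" for \<pi>
    unfolding Suc.IH using that by (simp add: T_sh sum_distrib_left)
  have "wedge_power \<Omega> (Suc k) x vs
      = (\<Sum>\<pi> | \<pi> permutes {..<2 + 2 * k}. (\<Sum>\<sigma> | \<sigma> permutes {..<2 * k}. T (\<pi> \<circ> sh \<sigma>)) / 2 ^ k)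
        / (fact 2 * fact (2 * k))"
    unfolding wedge_power.simps wedge_def
    by (intro arg_cong2[where f = divide] sum.cong refl inner) simp
  also have "\<dots> = (\<Sum>\<pi> | \<pi> permutes {..<2 + 2 * k}. \<Sum>\<sigma> | \<sigma> permutes {..<2 * k}. T (\<pi> \<circ> sh \<sigma>))
        / (2 ^ Suc k * fact (2 * k))"
    by (simp flip: sum_divide_distrib)
  \<comment> \<open>Reindexing by right composition removes \<open>sh \<sigma>\<close>. The inner
    sum no longer depends on \<open>\<sigma>\<close>, and the number of choices cancels
    \<open>fact (2 * k)\<close>.\<close>
  also have "(\<Sum>\<pi> | \<pi> permutes {..<2 + 2 * k}. \<Sum>\<sigma> | \<sigma> permutes {..<2 * k}. T (\<pi> \<circ> sh \<sigma>))
      = (\<Sum>\<sigma> | \<sigma> permutes {..<2 * k}. \<Sum>\<pi> | \<pi> permutes {..<2 + 2 * k}. T \<pi>)"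
  proof (subst sum.swap, rule sum.cong[OF refl])
    fix \<sigma> assume "\<sigma> \<in> {\<sigma>. \<sigma> permutes {..<2 * k}}"
    then have "sh \<sigma> permutes {..<2 + 2 * k}" using sh_perm' by blast
    from sum_permutations_compose_right[OF this, of T]
    show "(\<Sum>\<pi> | \<pi> permutes {..<2 + 2 * k}. T (\<pi> \<circ> sh \<sigma>)) = (\<Sum>\<pi> | \<pi> permutes {..<2 + 2 * k}. T \<pi>)" ..
  qed
  also have "\<dots> = fact (2 * k) * (\<Sum>\<pi> | \<pi> permutes {..<2 + 2 * k}. T \<pi>)"
    by (simp add: card_permutations)
  finally show ?case
    by (simp add: T_def)
qed

text \<open>A permutation of \<open>{..<2 * n}\<close> that preserves the pairs \<open>{2 * i, 2 * i + 1}\<close> permutes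
  the pairs by some \<open>\<rho>\<close>. Swapping inside a pair changes both factors of the product, and when
  nothing is swapped the permutation acts as \<open>\<rho>\<close> on the even and on the odd numbers, so its
  sign is a square.\<close>

lemma sign_pair_permutation:
  fixes \<pi> :: "nat \<Rightarrow> nat"
  assumes "\<pi> permutes {..<2 * n}"
    and "\<And>i. i < n \<Longrightarrow> \<pi> (2 * i + 1) = (if even (\<pi> (2 * i)) then \<pi> (2 * i) + 1 else \<pi> (2 * i) - 1)"
  shows "sign \<pi> * (\<Prod>i<n. (- 1) ^ \<pi> (2 * i)) = 1"
  using assms
\<comment> \<open>Induction on the number of pairs whose order is reversed; composing with a swap
  inside such a pair lowers it by one.\<close>
proof (induction "card {i. i < n \<and> odd (\<pi> (2 * i))}" arbitrary: \<pi>)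
  case 0
  note perm = \<open>\<pi> permutes {..<2 * n}\<close>
  have ev: "even (\<pi> (2 * i))" if "i < n" for i
    using 0(1) that by (auto simp: card_eq_0_iff)
  have odd: "\<pi> (2 * i + 1) = \<pi> (2 * i) + 1" if "i < n" for i
    using 0(3)[OF that] ev[OF that] by simp
  define \<rho> where "\<rho> i = \<pi> (2 * i) div 2" for i
  have \<pi>\<rho>: "\<pi> (2 * i) = 2 * \<rho> i" if "i < n" for i
    using ev[OF that] by (simp add: \<rho>_def)
  have \<rho>: "\<rho> permutes {..<n}"
  proof (rule bij_imp_permutes)
    have "inj_on \<rho> {..<n}"
    proof (rule inj_onI)
      fix i j assume "i \<in> {..<n}" "j \<in> {..<n}" "\<rho> i = \<rho> j"
      then have "\<pi> (2 * i) = \<pi> (2 * j)" by (simp add: \<pi>\<rho>)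
      then show "i = j" using permutes_inj[OF perm] by (simp add: inj_eq)
    qed
    moreover have "\<rho> ` {..<n} \<subseteq> {..<n}"
    proof
      fix x assume "x \<in> \<rho> ` {..<n}"
      then obtain i where i: "i < n" "x = \<rho> i" by auto
      then have "\<pi> (2 * i) < 2 * n" using permutes_in_image[OF perm, of "2 * i"] by simp
      then show "x \<in> {..<n}" using i by (simp add: \<pi>\<rho>)
    qed
    ultimately show "bij_betw \<rho> {..<n} {..<n}"
      by (simp add: bij_betw_def endo_inj_surj)
    show "\<rho> i = i" if "i \<notin> {..<n}" for i
      using permutes_not_in[OF perm, of "2 * i"] that by (simp add: \<rho>_def)
  qed
  define p0 where "p0 = map_permutation {..<n} (\<lambda>i. 2 * i) \<rho>"
  define p1 where "p1 = map_permutation {..<n} (\<lambda>i. 2 * i + 1) \<rho>"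
  have inj: "inj_on (\<lambda>i::nat. 2 * i) A" "inj_on (\<lambda>i::nat. 2 * i + 1) A" for A by (auto simp: inj_on_def)
  have p: "p0 permutes ((\<lambda>i. 2 * i) ` {..<n})" "p1 permutes ((\<lambda>i. 2 * i + 1) ` {..<n})"
    unfolding p0_def p1_def by (intro map_permutation_permutes inj_on_imp_bij_betw inj \<rho>)+
  have app: "p0 (2 * i) = 2 * \<rho> i" "p1 (2 * i + 1) = 2 * \<rho> i + 1" if "i < n" for i
    using that map_permutation_apply[OF inj(1), of i "{..<n}" \<rho>] map_permutation_apply[OF inj(2), of i "{..<n}" \<rho>]
    by (simp_all add: p0_def p1_def)
  have nin: "2 * i \<notin> (\<lambda>i. 2 * i + 1) ` A" "2 * i + 1 \<notin> (\<lambda>i. 2 * i) ` A" for i :: nat and A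
    by (auto; presburger)+
  have "\<pi> s = p0 (p1 s)" for s
  proof (cases "s < 2 * n")
    case True
    show ?thesis
    proof (cases "even s")
      case e: True
      then obtain i where i: "s = 2 * i" by blast
      then have "p1 s = s" using permutes_not_in[OF p(2)] nin by simp
      then show ?thesis using True i by (simp add: app \<pi>\<rho>)
    next
      case False
      then obtain i where i: "s = 2 * i + 1" by (elim oddE)
      then have "i < n" using True by simp
      then show ?thesis
        using permutes_not_in[OF p(1), of "2 * \<rho> i + 1"] nin(2)[of "\<rho> i"] app(2) odd
        by (simp add: i \<pi>\<rho>)
    qed
  next
    case False
    then have "s \<notin> (\<lambda>i. 2 * i) ` {..<n}" "s \<notin> (\<lambda>i. 2 * i + 1) ` {..<n}" by auto
    then have "p1 s = s" "p0 s = s" using permutes_not_in[OF p(1), of s] permutes_not_in[OF p(2), of s] by auto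
    then show ?thesis using permutes_not_in[OF perm, of s] False by simp
  qed
  then have "\<pi> = p0 \<circ> p1" by auto
  moreover have "sign p0 = sign \<rho>" "sign p1 = sign \<rho>"
    unfolding p0_def p1_def using \<rho> by (intro sign_map_permutation inj; simp)+
  moreover have "permutation p0" "permutation p1"
    using p by (auto intro: permutes_imp_permutation)
  ultimately have "sign \<pi> = 1" by (simp add: sign_compose)
  then show ?case using ev by simp
next
  case (Suc m)
  note perm = \<open>\<pi> permutes {..<2 * n}\<close> and pairs = Suc(4)
  let ?odd = "\<lambda>\<pi>. {i. i < n \<and> odd (\<pi> (2 * i))}"
  have "?odd \<pi> \<noteq> {}" using Suc(2) by force
  then obtain a where a: "a < n" "odd (\<pi> (2 * a))" by blast
  define t where "t = Transposition.transpose (2 * a) (2 * a + 1)"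
  have t: "t permutes {..<2 * n}" unfolding t_def using a by (intro permutes_swap_id) auto
  have t_other: "t (2 * i) = 2 * i" "t (2 * i + 1) = 2 * i + 1" if "i \<noteq> a" for i
    using that unfolding t_def by (auto simp: Transposition.transpose_def; presburger)+
  have t_a: "t (2 * a) = 2 * a + 1" "t (2 * a + 1) = 2 * a" by (auto simp: t_def)
  have ev: "even ((\<pi> \<circ> t) (2 * a))" using a pairs[OF a(1)] by (simp add: t_a)
  have "?odd (\<pi> \<circ> t) = ?odd \<pi> - {a}"
    using ev t_other by (auto simp: comp_def) (metis t_other(1))+
  then have "m = card (?odd (\<pi> \<circ> t))" using Suc(2) a by simp
  moreover have "(\<pi> \<circ> t) permutes {..<2 * n}" by (rule permutes_compose[OF t perm])
  moreover have "(\<pi> \<circ> t) (2 * i + 1)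
      = (if even ((\<pi> \<circ> t) (2 * i)) then (\<pi> \<circ> t) (2 * i) + 1 else (\<pi> \<circ> t) (2 * i) - 1)" if "i < n" for i
  proof (cases "i = a")
    case True
    \<comment> \<open>Positivity makes the natural-number subtraction of 1 reversible.\<close>
    have "\<pi> (2 * a) > 0" using a(2) by (rule odd_pos)
    then show ?thesis using a pairs[OF a(1)] True t_a by auto
  next
    case False
    then show ?thesis using pairs[OF that] t_other by simp
  qed
  ultimately have IH: "sign (\<pi> \<circ> t) * (\<Prod>i<n. (- 1) ^ (\<pi> \<circ> t) (2 * i)) = 1" by (rule Suc(1))
  have "sign (\<pi> \<circ> t) = - sign \<pi>"
    using perm t by (subst sign_compose)
      (auto simp: t_def sign_swap_id permutes_imp_permutation[of "{..<2 * n}"])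
  moreover have "(\<Prod>i<n. (- 1) ^ (\<pi> \<circ> t) (2 * i)) = - (\<Prod>i<n. (- 1) ^ \<pi> (2 * i) :: int)"
  proof -
    have "(\<Prod>i<n. (- 1) ^ (\<pi> \<circ> t) (2 * i))
        = (- 1) ^ (\<pi> \<circ> t) (2 * a) * (\<Prod>i\<in>{..<n} - {a}. (- 1) ^ (\<pi> \<circ> t) (2 * i) :: int)"
      using a by (intro prod.remove) auto
    also have "\<dots> = 1 * (\<Prod>i\<in>{..<n} - {a}. (- 1) ^ \<pi> (2 * i))"
      using ev by (intro arg_cong2[where f = times] prod.cong) (auto simp: t_other)
    also have "\<dots> = - ((- 1) ^ \<pi> (2 * a) * (\<Prod>i\<in>{..<n} - {a}. (- 1) ^ \<pi> (2 * i)))"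
      using a by simp
    also have "(- 1) ^ \<pi> (2 * a) * (\<Prod>i\<in>{..<n} - {a}. (- 1) ^ \<pi> (2 * i)) = (\<Prod>i<n. (- 1) ^ \<pi> (2 * i) :: int)"
      using a by (intro prod.remove[symmetric]) auto
    finally show ?thesis .
  qed
  ultimately show ?case using IH by simp
qed

text \<open>On the list \<open>a 0, b 0, a 1, b 1, ...\<close> every summand of
  \<open>wedge_power_eq_sum\<close> is 0 or 1 and the identity contributes 1, so nothing can
  cancel.\<close>

lemma wedge_power_hyperbolic:
  fixes a b :: "nat \<Rightarrow> 'g fibre"
  assumes ab: "\<And>i j. i < n \<Longrightarrow> j < n \<Longrightarrow> \<Omega> x [a i, b j] = (if i = j then 1 else 0)"
    and ba: "\<And>i j. i < n \<Longrightarrow> j < n \<Longrightarrow> \<Omega> x [b i, a j] = (if i = j then - 1 else 0)"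
    and aa: "\<And>i j. i < n \<Longrightarrow> j < n \<Longrightarrow> \<Omega> x [a i, a j] = 0"
    and bb: "\<And>i j. i < n \<Longrightarrow> j < n \<Longrightarrow> \<Omega> x [b i, b j] = 0"
  shows "\<not> form_zero_at (2 * n) (wedge_power \<Omega> n) x"
proof -
  define c where "c s = (if even s then a (s div 2) else b (s div 2))" for s
  define vs where "vs = map c [0..<2 * n]"
  have nth: "vs ! s = c s" if "s < 2 * n" for s using that by (simp add: vs_def)
  \<comment> \<open>The only partner of position \<open>s\<close> is \<open>s + 1\<close> for even
    \<open>s\<close> and \<open>s - 1\<close> for odd \<open>s\<close>; the parity of
    \<open>s\<close> gives the sign.\<close>
  have c: "\<Omega> x [c s, c t] = (if t = (if even s then s + 1 else s - 1) then (- 1) ^ s else 0)"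
    if "s < 2 * n" "t < 2 * n" for s t
  proof -
    obtain i where s: "s = 2 * i \<or> s = 2 * i + 1" by (metis evenE oddE)
    obtain j where t: "t = 2 * j \<or> t = 2 * j + 1" by (metis evenE oddE)
    have "i < n" "j < n" using s t that by auto
    then show ?thesis
      using s t by (elim disjE) (auto simp: c_def ab ba aa bb, presburger+)
  qed
  define T where "T \<pi> = real_of_int (sign \<pi>) * (\<Prod>i<n. \<Omega> x [vs ! \<pi> (2 * i), vs ! \<pi> (2 * i + 1)])" for \<pi>
  \<comment> \<open>A summand is nonzero only if the permutation preserves the pairs, and then its
    value is given by \<open>sign_pair_permutation\<close>.\<close>
  have T: "T \<pi> \<in> {0, 1}" if \<pi>: "\<pi> permutes {..<2 * n}" for \<pi>
  proof -
    have lt: "\<pi> s < 2 * n" if "s < 2 * n" for s using permutes_in_image[OF \<pi>, of s] that by simp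
    have f: "\<Omega> x [vs ! \<pi> (2 * i), vs ! \<pi> (2 * i + 1)]
      = (if \<pi> (2 * i + 1) = (if even (\<pi> (2 * i)) then \<pi> (2 * i) + 1 else \<pi> (2 * i) - 1)
         then (- 1) ^ \<pi> (2 * i) else 0)" if "i < n" for i
      using that lt[of "2 * i"] lt[of "2 * i + 1"] by (simp only: nth c)
    show ?thesis
    proof (cases "\<forall>i<n. \<pi> (2 * i + 1) = (if even (\<pi> (2 * i)) then \<pi> (2 * i) + 1 else \<pi> (2 * i) - 1)")
      case True
      then have "T \<pi> = real_of_int (sign \<pi> * (\<Prod>i<n. (- 1) ^ \<pi> (2 * i)))"
        unfolding T_def using f by simp
      also have "sign \<pi> * (\<Prod>i<n. (- 1) ^ \<pi> (2 * i)) = 1"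
        using True by (intro sign_pair_permutation \<pi>) blast
      finally show ?thesis by simp
    next
      case False
      then obtain i where "i < n" "\<Omega> x [vs ! \<pi> (2 * i), vs ! \<pi> (2 * i + 1)] = 0"
        using f by metis
      then have "(\<Prod>i<n. \<Omega> x [vs ! \<pi> (2 * i), vs ! \<pi> (2 * i + 1)]) = 0"
        by (intro prod_zero) auto
      then show ?thesis by (simp add: T_def)
    qed
  qed
  have "T id = 1"
    by (simp add: T_def nth c)
  moreover have "T id \<le> (\<Sum>\<pi> | \<pi> permutes {..<2 * n}. T \<pi>)"
  proof (rule member_le_sum)
    show "id \<in> {\<pi>. \<pi> permutes {..<2 * n}}" using permutes_id by blast
    show "0 \<le> T \<pi>" if "\<pi> \<in> {\<pi>. \<pi> permutes {..<2 * n}} - {id}" for \<pi>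
      using T[of \<pi>] that by auto
  qed (simp add: finite_permutations)
  ultimately have "wedge_power \<Omega> n x vs \<noteq> 0"
    unfolding wedge_power_eq_sum T_def[symmetric] by simp
  moreover have "length vs = 2 * n" by (simp add: vs_def)
  ultimately show ?thesis unfolding form_zero_at_def by blast
qed

section \<open>Two-forms and multiplier matrices\<close>

lemma length_2_cases:
  assumes "length vs = 2"
  obtains x y where "vs = [x, y]"
  using assms by (auto simp: numeral_2_eq_2 length_Suc_conv)

lemma smooth_two_form_of_is_form:
  fixes \<Omega> :: "('g::euclidean_space) form"
  assumes lie: "lie_algebra br" and form: "is_form 2 \<Omega>"
  shows "smooth_two_form br (\<lambda>p x y. \<Omega> p [x, y])"
proof (rule smooth_two_form.intro)
  have alt: "alternating_multilinear 2 (\<Omega> p)" for p using form unfolding is_form_def by blast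
  have lin: "linear (\<lambda>v. \<Omega> p ([x, y][i := v]))" if "i < 2" for p x y i
    using alt[of p, unfolded alternating_multilinear_def, THEN conjunct1, rule_format, of "[x, y]" i] that
    by (simp only: length_Cons list.size One_nat_def numeral_2_eq_2 add_0_right add_Suc_right)
  show l2: "linear (\<lambda>y. \<Omega> p [x, y])" for p x
    using lin[of 1 p x] by simp
  have l1: "linear (\<lambda>x. \<Omega> p [x, y])" for p y
    using lin[of 0 p _ y] by simp
  have self: "\<Omega> p [x, x] = 0" for p x
    using alt[of p] by (simp add: alternating_multilinear_def)
  show "\<Omega> p [x, y] = - \<Omega> p [y, x]" for p x y
    using self[of p "x + y"] self[of p x] self[of p y]
    by (simp add: linear_add[OF l2] linear_add[OF l1])
  show "smooth (\<lambda>p. \<Omega> p [x, y])" for x y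
    using form by (simp add: is_form_def)
qed (rule lie)

context smooth_two_form
begin

lemma is_form_B: "is_form 2 (\<lambda>p vs. B p (vs ! 0) (vs ! 1))"
  unfolding is_form_def alternating_multilinear_def
proof (intro conjI allI impI; (elim conjE)?)
  show "linear (\<lambda>v. B p (vs[i := v] ! 0) (vs[i := v] ! 1))" if "length vs = 2" "i < 2" for p vs i
  proof -
    obtain x y where "vs = [x, y]" using \<open>length vs = 2\<close> by (rule length_2_cases)
    then show ?thesis
      using \<open>i < 2\<close> linB[of p x] linB_left[of p y] by (auto simp: less_2_cases_iff)
  qed
  show "B p (vs ! 0) (vs ! 1) = 0" if "length vs = 2" "\<not> distinct vs" for p vs
    using that by (elim length_2_cases) auto
qed (rule smoothB)

lemma form_closed_iff_delta2:
  assumes \<Omega>: "\<And>p x y. \<Omega> p [x, y] = B p x y"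
  shows "form_closed br 2 \<Omega> \<longleftrightarrow> (\<forall>p x y z. delta2 br B p x y z = 0)"
proof
  assume closed: "form_closed br 2 \<Omega>"
  show "\<forall>p x y z. delta2 br B p x y z = 0"
  proof (intro allI)
    fix p x y z
    have "ext_deriv br \<Omega> [\<lambda>_. x, \<lambda>_. y, \<lambda>_. z] p = 0"
      using closed[unfolded form_closed_def, rule_format, of "[\<lambda>_. x, \<lambda>_. y, \<lambda>_. z]"] by simp
    then show "delta2 br B p x y z = 0"
      by (simp add: ext_deriv_eq_delta2[OF \<Omega>])
  qed
next
  assume closed: "\<forall>p x y z. delta2 br B p x y z = 0"
  show "form_closed br 2 \<Omega>"
    unfolding form_closed_def
  proof (intro allI impI; elim conjE)
    fix \<sigma>s :: "'g sect list" and p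
    assume "length \<sigma>s = Suc 2" and sm: "\<forall>\<sigma>\<in>set \<sigma>s. smooth \<sigma>"
    then obtain s t u where "\<sigma>s = [s, t, u]" by (auto simp: numeral_2_eq_2 length_Suc_conv)
    then show "ext_deriv br \<Omega> \<sigma>s p = 0"
      using sm closed[rule_format] by (simp add: ext_deriv_eq_delta2[OF \<Omega>] smooth_imp_differentiable)
  qed
qed

end

context semibasic_two_form
begin

text \<open>The equation for \<open>B p (e i) (e j)\<close> says that the vectors \<open>e i\<close>
  minus the sum of \<open>\<Lambda> i l p *\<^sub>R W l\<close> span an isotropic space. It is the
  one condition here that constrains the form beyond \<open>K\<close>.\<close>

lemma closed_iff_reduced_multiplier_equations:
  "(\<forall>p x y z. \<Delta> p x y z = 0) \<longleftrightarrow>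
    (\<forall>p i j. K i j p = K j i p) \<and>
    (\<forall>p i j. gam_deriv E \<gamma> (K i j) p
      = (\<Sum>l\<in>UNIV. \<Lambda> i l p * K l j p) + (\<Sum>l\<in>UNIV. \<Lambda> j l p * K l i p)) \<and>
    (\<forall>p i j. B p (e i) (e j)
      = (\<Sum>l\<in>UNIV. \<Lambda> i l p * K l j p) - (\<Sum>l\<in>UNIV. \<Lambda> j l p * K l i p)) \<and>
    (\<forall>p i j. (\<Sum>l\<in>UNIV. K l i p * phi br E \<gamma> j l p) = (\<Sum>l\<in>UNIV. K l j p * phi br E \<gamma> i l p)) \<and>
    (\<forall>p i j k. pdw E i (K j k) p = pdw E j (K i k) p)"
  (is "?closed \<longleftrightarrow> ?sym \<and> ?mult \<and> ?horiz \<and> ?phi \<and> ?pdw")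
proof
  assume closed: ?closed
  have sym: "K i j p = K j i p" for i j p
    using delta2_Gamma0_W_W[of p i j] closed by simp
  then have sym': "K i j = K j i" for i j by blast
  have we: "gam_deriv E \<gamma> (K i j) p + B p (e i) (e j) = 2 * (\<Sum>l\<in>UNIV. \<Lambda> i l p * K l j p)" for i j p
    using delta2_Gamma0_W_e[of p i j] closed by simp
  \<comment> \<open>These are the symmetric and the skew part in \<open>i, j\<close> of the single
    equation \<open>we\<close>.\<close>
  have mult: "gam_deriv E \<gamma> (K i j) p
      = (\<Sum>l\<in>UNIV. \<Lambda> i l p * K l j p) + (\<Sum>l\<in>UNIV. \<Lambda> j l p * K l i p)"
    and horiz: "B p (e i) (e j)
      = (\<Sum>l\<in>UNIV. \<Lambda> i l p * K l j p) - (\<Sum>l\<in>UNIV. \<Lambda> j l p * K l i p)" for i j p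
    using we[of i j p] we[of j i p] skew[of p "e i" "e j"] unfolding sym'[of j i] by linarith+
  have ee: "\<Delta> p (\<Gamma> p) (e i) (e j) = (\<Sum>l\<in>UNIV. K l i p * phi br E \<gamma> j l p) - (\<Sum>l\<in>UNIV. K l j p * phi br E \<gamma> i l p)"
    for i j p by (rule delta2_Gamma0_e_e_phi[OF sym mult horiz])
  have "(\<Sum>l\<in>UNIV. K l i p * phi br E \<gamma> j l p) = (\<Sum>l\<in>UNIV. K l j p * phi br E \<gamma> i l p)" for i j p
    using ee[of p i j] closed[rule_format, of p "\<Gamma> p" "e i" "e j"] by simp
  moreover have "pdw E i (K j k) p = pdw E j (K i k) p" for i j k p
    using delta2_W_W_e[of p i j k] closed by simp
  ultimately show "?sym \<and> ?mult \<and> ?horiz \<and> ?phi \<and> ?pdw"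
    using sym mult horiz by blast
next
  assume "?sym \<and> ?mult \<and> ?horiz \<and> ?phi \<and> ?pdw"
  then have sym: ?sym and mult: ?mult and horiz: ?horiz and phi: ?phi and pdw: ?pdw
    by blast+
  have "\<Delta> p (\<Gamma> p) (e i) (e j) = (\<Sum>l\<in>UNIV. K l i p * phi br E \<gamma> j l p) - (\<Sum>l\<in>UNIV. K l j p * phi br E \<gamma> i l p)"
    for i j p by (rule delta2_Gamma0_e_e_phi[OF sym[rule_format] mult[rule_format] horiz[rule_format]])
  then have ee: "\<Delta> p (\<Gamma> p) (e i) (e j) = 0" for p i j
    using phi[rule_format, of p i j] by simp
  have We: "\<Delta> p (\<Gamma> p) (W i) (e j) = 0" for p i j
    using delta2_Gamma0_W_e[of p i j] mult[rule_format, of i j p] horiz[rule_format, of p i j] by simp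
  have WW: "\<Delta> p (\<Gamma> p) (W i) (W j) = 0" for p i j
    using delta2_Gamma0_W_W[of p i j] sym[rule_format, of p i j] by simp
  have WWe: "\<Delta> p (W i) (W j) (e k) = 0" for p i j k
    using delta2_W_W_e[of p i j k] pdw[rule_format, of i j k p] by simp
  show ?closed
    using delta2_eq_0[OF delta2_Gamma0_eq_0[OF WW We ee] WWe] by blast
qed

lemma reduced_multiplier_K_iff:
  "reduced_multiplier br E \<gamma> K \<longleftrightarrow>
    (\<forall>p. det (\<chi> i j. K i j p) \<noteq> 0) \<and>
    (\<forall>p i j. K i j p = K j i p) \<and>
    (\<forall>p i j. gam_deriv E \<gamma> (K i j) p
      = (\<Sum>l\<in>UNIV. \<Lambda> i l p * K l j p) + (\<Sum>l\<in>UNIV. \<Lambda> j l p * K l i p)) \<and>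
    (\<forall>p i j. (\<Sum>l\<in>UNIV. K l i p * phi br E \<gamma> j l p) = (\<Sum>l\<in>UNIV. K l j p * phi br E \<gamma> i l p)) \<and>
    (\<forall>p i j k. pdw E i (K j k) p = pdw E j (K i k) p)"
proof -
  have "(\<Sum>k\<in>UNIV. K k j p * \<Lambda> i k p) = (\<Sum>l\<in>UNIV. \<Lambda> i l p * K l j p)" for i j p
    by (simp add: mult.commute)
  moreover have "(\<Sum>k\<in>UNIV. K i k p * \<Lambda> j k p) = (\<Sum>l\<in>UNIV. \<Lambda> j l p * K l i p)"
    if "\<forall>p i j. K i j p = K j i p" for i j p
    using that by (intro sum.cong refl) (metis mult.commute)
  ultimately show ?thesis
    unfolding reduced_multiplier_def using smoothB
    by (auto simp: diff_diff_eq)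
qed

text \<open>Replacing \<open>e i\<close> by \<open>H i\<close> gives two isotropic families paired
  by \<open>K\<close>. Inverting \<open>K\<close> makes them dual, which is the situation of
  \<open>wedge_power_hyperbolic\<close>.\<close>

lemma wedge_power_nonzero:
  assumes \<Omega>: "\<And>x y. \<Omega> p [x, y] = B p x y"
    and det: "det (\<chi> i j. K i j p) \<noteq> 0"
    and horiz: "\<And>i j. B p (e i) (e j)
      = (\<Sum>l\<in>UNIV. \<Lambda> i l p * K l j p) - (\<Sum>l\<in>UNIV. \<Lambda> j l p * K l i p)"
  shows "\<not> form_zero_at (2 * CARD('n)) (wedge_power \<Omega> CARD('n)) p"
proof -
  define H where "H i = e i - (\<Sum>l\<in>UNIV. \<Lambda> i l p *\<^sub>R W l)" for i
  have WH: "B p (W i) (H j) = K i j p" for i j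
    by (simp add: H_def B_simps B_W_W del: scaleR_Pair diff_Pair)
  have HH: "B p (H i) (H j) = 0" for i j
    by (simp add: H_def B_simps B_W_W B_e_W horiz sum_negf del: scaleR_Pair diff_Pair)
  define A where "A = (\<chi> i j. K i j p)"
  obtain M where "A ** M = mat 1"
    using det unfolding A_def[symmetric] by (auto simp: invertible_def simp flip: invertible_det_nz)
  then have AM: "(\<Sum>l\<in>UNIV. K i l p * M $ l $ j) = (if i = j then 1 else 0)" for i j
    by (auto simp: vec_eq_iff matrix_matrix_mult_def mat_def A_def)
  \<comment> \<open>The inverse matrix \<open>M\<close> recombines the \<open>H l\<close> into the
    family dual to the \<open>W i\<close>.\<close>
  define b where "b j = (\<Sum>l\<in>UNIV. M $ l $ j *\<^sub>R H l)" for j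
  have Wb: "B p (W i) (b j) = (if i = j then 1 else 0)" for i j
    using AM[of i j] by (simp add: b_def B_simps WH mult.commute)
  have bb: "B p (b i) (b j) = 0" for i j
    by (simp add: b_def B_simps HH)
  have bW: "B p (b j) (W i) = (if j = i then - 1 else 0)" for i j
    using skew[of p "b j" "W i"] Wb[of i j] by simp
  obtain f where "bij_betw f {0..<CARD('n)} (UNIV :: 'n set)"
    using ex_bij_betw_nat_finite[of "UNIV :: 'n set"] by auto
  then have f: "f i = f j \<longleftrightarrow> i = j" if "i < CARD('n)" "j < CARD('n)" for i j
    using that by (auto simp: bij_betw_def inj_on_def)
  show ?thesis
    by (rule wedge_power_hyperbolic[where a = "\<lambda>i. W (f i)" and b = "\<lambda>i. b (f i)"])
      (simp_all add: \<Omega> Wb bW bb B_W_W f)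
qed

text \<open>A left null vector of \<open>K\<close> gives a vertical vector annihilated by the form.
  Together with \<open>\<Gamma> p\<close> it spans a two-dimensional kernel in a fibre of dimension
  \<open>2 * CARD('n) + 1\<close>, too large for rank \<open>2 * CARD('n)\<close>.\<close>

lemma wedge_power_zero:
  assumes \<Omega>: "\<And>x y. \<Omega> p [x, y] = B p x y" and alt: "alternating_multilinear 2 (\<Omega> p)"
    and det: "det (\<chi> i j. K i j p) = 0"
  shows "form_zero_at (2 * CARD('n)) (wedge_power \<Omega> CARD('n)) p"
proof -
  define A where "A = (\<chi> i j. K i j p)"
  have "det (transpose A) = 0" using det by (simp add: A_def det_transpose)
  then have "\<not> invertible (transpose A)" by (simp add: invertible_det_nz)
  then obtain c where c: "transpose A *v c = 0" "c \<noteq> 0"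
    by (auto simp: invertible_left_inverse matrix_left_invertible_ker)
  have cK: "(\<Sum>i\<in>UNIV. c $ i * K i j p) = 0" for j
    using arg_cong[OF c(1), of "\<lambda>v. v $ j"]
    by (simp add: matrix_vector_mult_def transpose_def A_def mult.commute)
  define w where "w = (\<Sum>i\<in>UNIV. c $ i *\<^sub>R W i)"
  have w: "w = (0, 0, \<Sum>i\<in>UNIV. c $ i *\<^sub>R E i)" by (simp add: w_def sum_prod)
  have "w \<noteq> 0"
  proof
    assume "w = 0"
    then have "(\<Sum>i\<in>UNIV. c $ i *\<^sub>R E i) = 0" by (simp add: w zero_prod_def)
    then have "coord E j (\<Sum>i\<in>UNIV. c $ i *\<^sub>R E i) = 0" for j
      by (simp add: linear_0[OF linear_coord[OF basis]])
    then have "c $ j = 0" for j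
      by (simp add: linear_sum[OF linear_coord[OF basis]] linear_scale[OF linear_coord[OF basis]]
          coord_basis[OF basis] if_distrib[of "(*) _"] cong: if_cong)
    then show False using c(2) by (simp add: vec_eq_iff)
  qed
  have \<Gamma>_right: "B p y (\<Gamma> p) = 0" for y
    using skew[of p y "\<Gamma> p"] B_Gamma0 by simp
  have wy: "B p w y = 0" for y
  proof (rule linear_zero_on_frame[where p = p, OF linB])
    show "B p w (e j) = 0" for j
      using cK[of j] by (simp add: w_def B_simps del: scaleR_Pair)
    show "B p w (W j) = 0" for j
      by (simp add: w_def B_simps B_W_W del: scaleR_Pair)
  qed (rule \<Gamma>_right)
  let ?N = "span {\<Gamma> p, w}"
  have ker: "B p u y = 0" if "u \<in> ?N" for u y
    by (rule linear_eq_0_on_span[OF linB_left _ that]) (metis insertE singletonD B_Gamma0 wy)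
  \<comment> \<open>The first component of \<open>\<Gamma> p\<close> is 1, that of \<open>w\<close>
    is 0.\<close>
  have "\<Gamma> p \<notin> span {w}"
    by (auto simp: real_vector.span_singleton w Gamma0_eq)
  then have "independent {\<Gamma> p, w}" "\<Gamma> p \<noteq> w"
    using \<open>w \<noteq> 0\<close> by (auto simp: real_vector.independent_insert real_vector.span_base)
  then have "dim ?N = 2" by (simp add: dim_eq_card_independent)
  moreover have "DIM('g) = CARD('n)"
    using basis by (metis is_basis_def dim_span_eq_card_independent dim_UNIV card_image)
  ultimately have "DIM('g fibre) < dim ?N + 2 * CARD('n)" by simp
  moreover have "B p y u = 0" if "u \<in> ?N" for u y
    using skew[of p y u] ker[OF that] by simp
  ultimately show ?thesis
    using ker by (intro wedge_power_eq_0[where N = ?N] alt subspace_span) (simp_all only: \<Omega>)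
qed

end

section \<open>The two-form of a multiplier matrix\<close>

context ip_algebroid
begin

definition horizontal_coord :: "'n \<Rightarrow> real \<times> 'g \<Rightarrow> 'g fibre \<Rightarrow> real" where
  "horizontal_coord j p x = coord E j (fst (snd x)) - fst x * coord E j (snd p)"

definition vertical_coord :: "'n \<Rightarrow> real \<times> 'g \<Rightarrow> 'g fibre \<Rightarrow> real" where
  "vertical_coord i p x = coord E i (snd (snd x)) - fst x * \<gamma> i p
     + (\<Sum>l\<in>UNIV. \<Lambda> l i p * horizontal_coord l p x)"

text \<open>\<open>x = \<xi> \<Gamma> + h\<^sup>j H\<^sub>j + v\<^sup>i W\<^sub>i\<close> with \<open>H\<^sub>j = e\<^sub>j - \<lambda>\<^sub>j\<^sup>k W\<^sub>k\<close>, where \<open>h\<^sup>j\<close> and \<open>v\<^sup>i\<close> are the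
  horizontal and the vertical coordinates of \<open>x\<close>; the form below is
  \<open>k\<^sub>i\<^sub>j v\<^sup>i \<and> h\<^sup>j\<close>.\<close>

definition multiplier_form :: "('n \<Rightarrow> 'n \<Rightarrow> real \<times> 'g \<Rightarrow> real) \<Rightarrow> real \<times> 'g \<Rightarrow>
    'g fibre \<Rightarrow> 'g fibre \<Rightarrow> real" where
  "multiplier_form k p x y = (\<Sum>i\<in>UNIV. \<Sum>j\<in>UNIV. k i j p *
     (vertical_coord i p x * horizontal_coord j p y - vertical_coord i p y * horizontal_coord j p x))"

lemma linear_horizontal_coord: "linear (horizontal_coord j p)"
  unfolding horizontal_coord_def
  by (rule linearI) (simp_all add: linear_add[OF linear_coord[OF basis]]
      linear_scale[OF linear_coord[OF basis]] algebra_simps)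

lemma linear_vertical_coord: "linear (vertical_coord i p)"
  unfolding vertical_coord_def
  by (rule linearI) (simp_all add: linear_add[OF linear_coord[OF basis]]
      linear_scale[OF linear_coord[OF basis]] linear_add[OF linear_horizontal_coord]
      linear_scale[OF linear_horizontal_coord] algebra_simps sum.distrib sum_distrib_left)

lemma coord_0: "coord E j 0 = 0"
  by (rule linear_0[OF linear_coord[OF basis]])

lemma horizontal_coord_frame:
  "horizontal_coord j p (\<Gamma> p) = 0" "horizontal_coord j p (e i) = (if j = i then 1 else 0)"
  "horizontal_coord j p (W i) = 0"
  by (simp_all add: horizontal_coord_def Gamma0_eq coord_basis[OF basis] coord_0)

lemma vertical_coord_frame:
  "vertical_coord j p (\<Gamma> p) = 0" "vertical_coord j p (e i) = \<Lambda> i j p"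
  "vertical_coord j p (W i) = (if j = i then 1 else 0)"
  by (simp_all add: vertical_coord_def horizontal_coord_frame)
    (simp_all add: Gamma0_eq coord_basis[OF basis] coord_0 linear_sum[OF linear_coord[OF basis]]
      linear_scale[OF linear_coord[OF basis]] if_distrib[of "(*) _"] cong: if_cong)

lemma semibasic_multiplier_form:
  assumes "\<And>i j. smooth (k i j)"
  shows "semibasic_two_form br E \<gamma> (multiplier_form k)"
proof (intro semibasic_two_form.intro smooth_two_form.intro semibasic_two_form_axioms.intro)
  show "ip_algebroid br E \<gamma>" by (rule ip_algebroid_axioms)
  show "lie_algebra br" by (rule lie_br)
  show "linear (multiplier_form k p x)" for p x
    unfolding multiplier_form_def
    by (rule linearI) (simp_all add: linear_add[OF linear_horizontal_coord] linear_scale[OF linear_horizontal_coord]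
        linear_add[OF linear_vertical_coord] linear_scale[OF linear_vertical_coord]
        algebra_simps sum.distrib sum_subtractf sum_distrib_left)
  show "multiplier_form k p x y = - multiplier_form k p y x" for p x y
    by (simp add: multiplier_form_def algebra_simps flip: sum_negf)
  have h: "smooth (\<lambda>p. horizontal_coord j p x)" for j x
    unfolding horizontal_coord_def by (intro smooth_diff smooth_mult smooth_const smooth_coord)
  have v: "smooth (\<lambda>p. vertical_coord j p x)" for j x
    unfolding vertical_coord_def
    by (intro smooth_add smooth_diff smooth_sum smooth_mult smooth_const smooth_\<gamma> smooth_lam h)
  show "smooth (\<lambda>p. multiplier_form k p x y)" for x y
    unfolding multiplier_form_def by (intro smooth_sum smooth_diff smooth_mult assms h v)
  show "multiplier_form k p (W i) (W j) = 0" for p i j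
    by (simp add: multiplier_form_def horizontal_coord_frame)
  show "multiplier_form k p (\<Gamma> p) y = 0" for p y
    by (simp add: multiplier_form_def horizontal_coord_frame vertical_coord_frame)
qed

lemma multiplier_form_W_e: "multiplier_form k p (W i) (e j) = k i j p"
  by (simp add: multiplier_form_def horizontal_coord_frame vertical_coord_frame
      if_distrib[of "\<lambda>x. x * _"] if_distrib[of "(*) _"] cong: if_cong)

text \<open>The vertical coordinates of \<open>e i\<close> are the entries
  \<open>\<Lambda> i l p\<close>, by the choice of horizontal vectors. This builds the isotropy
  required by \<open>closed_iff_reduced_multiplier_equations\<close> into the form.\<close>

lemma multiplier_form_e_e: "multiplier_form k p (e i) (e j)
    = (\<Sum>l\<in>UNIV. \<Lambda> i l p * k l j p) - (\<Sum>l\<in>UNIV. \<Lambda> j l p * k l i p)"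
  by (simp add: multiplier_form_def horizontal_coord_frame vertical_coord_frame right_diff_distrib
      sum_subtractf mult.commute if_distrib[of "\<lambda>x. x * _"] if_distrib[of "(*) _"] cong: if_cong)

end

theorem theorem1:
  fixes br :: "'g::euclidean_space \<Rightarrow> 'g \<Rightarrow> 'g"
    and E :: "'n::finite \<Rightarrow> 'g"
    and \<gamma> :: "'n \<Rightarrow> real \<times> 'g \<Rightarrow> real"
  assumes "lie_algebra br"
    and "is_basis E"
    and "\<And>i. smooth (\<gamma> i)"
  shows "(\<exists>K. reduced_multiplier br E \<gamma> K) \<longleftrightarrow>
    (\<exists>\<Omega>. is_form 2 \<Omega> \<and>
      (\<forall>p. \<not> form_zero_at (2 * CARD('n)) (wedge_power \<Omega> CARD('n)) p) \<and>
      (\<forall>i j p. eval_form \<Omega> [We E i, We E j] p = 0) \<and>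
      (\<forall>p. form_zero_at 1 (interior_product (Gamma0 E \<gamma>) \<Omega>) p) \<and>
      form_closed br 2 \<Omega>)"
proof
  interpret ip_algebroid br E \<gamma>
    using assms by unfold_locales
  assume "\<exists>K. reduced_multiplier br E \<gamma> K"
  then obtain k where k: "reduced_multiplier br E \<gamma> k" by blast
  define B where "B = multiplier_form k"
  interpret semibasic_two_form br E \<gamma> B
    unfolding B_def using k by (intro semibasic_multiplier_form) (simp add: reduced_multiplier_def)
  \<comment> \<open>The matrix that the locale reads off from the form is the given multiplier, so
    the equivalences stated for \<open>K\<close> apply to \<open>k\<close>.\<close>
  have K: "K = k" by (simp add: fun_eq_iff B_def multiplier_form_W_e)
  have horiz: "B p (e i) (e j) = (\<Sum>l\<in>UNIV. \<Lambda> i l p * K l j p) - (\<Sum>l\<in>UNIV. \<Lambda> j l p * K l i p)" for p i j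
    by (simp add: B_def multiplier_form_e_e multiplier_form_W_e)
  have eqs: "reduced_multiplier br E \<gamma> K" using k by (simp add: K)
  then have closed: "\<forall>p x y z. \<Delta> p x y z = 0"
    unfolding reduced_multiplier_K_iff closed_iff_reduced_multiplier_equations using horiz by blast
  define \<Omega> where "\<Omega> = (\<lambda>p vs. B p (vs ! 0) (vs ! 1))"
  have \<Omega>: "\<Omega> p [x, y] = B p x y" for p x y by (simp add: \<Omega>_def)
  have "is_form 2 \<Omega>" unfolding \<Omega>_def by (rule is_form_B)
  moreover have "\<not> form_zero_at (2 * CARD('n)) (wedge_power \<Omega> CARD('n)) p" for p
    using eqs unfolding reduced_multiplier_K_iff by (intro wedge_power_nonzero \<Omega> horiz) blast
  moreover have "eval_form \<Omega> [We E i, We E j] p = 0" for i j p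
    by (simp add: eval_form_def We_def \<Omega> B_W_W)
  moreover have "form_zero_at 1 (interior_product \<Gamma> \<Omega>) p" for p
    by (auto simp: form_zero_at_def interior_product_def length_Suc_conv \<Omega> B_Gamma0)
  moreover have "form_closed br 2 \<Omega>"
    using closed form_closed_iff_delta2[OF \<Omega>] by blast
  ultimately show "\<exists>\<Omega>. is_form 2 \<Omega> \<and>
      (\<forall>p. \<not> form_zero_at (2 * CARD('n)) (wedge_power \<Omega> CARD('n)) p) \<and>
      (\<forall>i j p. eval_form \<Omega> [We E i, We E j] p = 0) \<and>
      (\<forall>p. form_zero_at 1 (interior_product (Gamma0 E \<gamma>) \<Omega>) p) \<and>
      form_closed br 2 \<Omega>"
    by blast
next
  interpret ip_algebroid br E \<gamma>
    using assms by unfold_locales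
  assume "\<exists>\<Omega>. is_form 2 \<Omega> \<and>
      (\<forall>p. \<not> form_zero_at (2 * CARD('n)) (wedge_power \<Omega> CARD('n)) p) \<and>
      (\<forall>i j p. eval_form \<Omega> [We E i, We E j] p = 0) \<and>
      (\<forall>p. form_zero_at 1 (interior_product (Gamma0 E \<gamma>) \<Omega>) p) \<and>
      form_closed br 2 \<Omega>"
  then obtain \<Omega> where form: "is_form 2 \<Omega>"
    and rank: "\<And>p. \<not> form_zero_at (2 * CARD('n)) (wedge_power \<Omega> CARD('n)) p"
    and WW: "\<And>i j p. eval_form \<Omega> [We E i, We E j] p = 0"
    and ker: "\<And>p. form_zero_at 1 (interior_product (Gamma0 E \<gamma>) \<Omega>) p"
    and closed: "form_closed br 2 \<Omega>"
    by blast
  define B where "B = (\<lambda>p x y. \<Omega> p [x, y])"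
  interpret smooth_two_form br B
    unfolding B_def using assms(1) form by (rule smooth_two_form_of_is_form)
  interpret semibasic_two_form br E \<gamma> B
  proof
    show "B p (0, 0, E i) (0, 0, E j) = 0" for p i j
      using WW[of i j p] by (simp add: B_def eval_form_def We_def)
    show "B p (\<Gamma> p) y = 0" for p y
      using ker[of p] by (simp add: B_def form_zero_at_def interior_product_def)
  qed
  have \<Omega>: "\<Omega> p [x, y] = B p x y" for p x y by (simp add: B_def)
  have "alternating_multilinear 2 (\<Omega> p)" for p using form unfolding is_form_def by blast
  \<comment> \<open>A singular matrix at \<open>p\<close> would make the top power vanish there,
    against the rank assumption.\<close>
  then have "det (\<chi> i j. K i j p) \<noteq> 0" for p
    using rank wedge_power_zero[where \<Omega> = \<Omega>, OF \<Omega>] by blast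
  moreover have "\<forall>p x y z. \<Delta> p x y z = 0"
    using closed form_closed_iff_delta2[OF \<Omega>] by blast
  ultimately have "reduced_multiplier br E \<gamma> K"
    unfolding reduced_multiplier_K_iff closed_iff_reduced_multiplier_equations by blast
  then show "\<exists>K. reduced_multiplier br E \<gamma> K" by blast
qed

end
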